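(* (In $\mathbf{ZF}$.) A zero-dimensional $T_1$-space $\mathbf{X}$ is $\mathbb{N}$-compact if and only if every clopen ultrafilter in $\mathbf{X}$ with the countable intersection property is fixed.
   Context: The base theory is $\mathbf{ZF}$ (the Axiom of Choice is not assumed). A space is zero-dimensional if its clopen sets form a base. A space is $\mathbb{N}$-compact if for some non-empty set $J$ it is homeomorphic with a closed subspace of $\mathbb{N}^J$, where $\mathbb{N}$ carries the discrete topology. A clopen filter in $\mathbf{X}$ is a filter in the family $\mathcal{CO}(\mathbf{X})$ of all clopen subsets of $\mathbf{X}$: a non-empty subfamily of $\mathcal{CO}(\mathbf{X})$ not containing $\emptyset$, closed under finite intersections and under supersets belonging to $\mathcal{CO}(\mathbf{X})$. A clopen ultrafilter is a maximal clopen filter. A filter $\mathcal{F}$ is fixed if $\bigcap\mathcal{F}\neq\emptyset$; it has the countable intersection property if $\bigcap\mathcal{H}\neq\emptyset$ for every non-empty countable (equipotent to a subset of $\omega$) $\mathcal{H}\subseteq\mathcal{F}$. *)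

theory Defs
  imports Main
begin

text \<open>
  HOL proves the axiom of choice, so a statement about HOL sets cannot express that something
  holds in ZF. Here "in ZF" is rendered semantically: \<open>(V, mem)\<close> is an arbitrary model of
  first-order ZF, where \<open>V\<close> is the universe of a type \<open>'v\<close>, and the set-theoretic statement is
  interpreted in it. By soundness and completeness, truth in all models is provability in ZF.
  Separation and replacement are therefore restricted to relations given by a first-order formula
  with parameters; if they were stated for all HOL predicates, every model would satisfy choice.
  Apart from \<open>sat\<close> and the axiom schemes of \<open>ZF_model\<close>, every quantifier below ranges over elements
  of the model, so each notion is a first-order formula in \<open>mem\<close>.
\<close>

section \<open>First-order formulas of set theory\<close>

text \<open>Variables are de Bruijn indices: \<open>Forall\<close> binds index 0.\<close>

datatype fm = Member nat nat | Equal nat nat | Neg fm | Conj fm fm | Forall fm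

primrec sat :: "('v \<Rightarrow> 'v \<Rightarrow> bool) \<Rightarrow> fm \<Rightarrow> (nat \<Rightarrow> 'v) \<Rightarrow> bool" where
  "sat mem (Member i j) s \<longleftrightarrow> mem (s i) (s j)"
| "sat mem (Equal i j) s \<longleftrightarrow> s i = s j"
| "sat mem (Neg p) s \<longleftrightarrow> \<not> sat mem p s"
| "sat mem (Conj p q) s \<longleftrightarrow> sat mem p s \<and> sat mem q s"
| "sat mem (Forall p) s \<longleftrightarrow> (\<forall>a. sat mem p (case_nat a s))"

section \<open>Set-theoretic notions\<close>

text \<open>
  Operations are given by their graphs (\<open>is_Union u S\<close> says that \<open>u\<close> is the union of \<open>S\<close>).
  The locale has no assumptions and only fixes the notation.
\<close>

locale set_structure =
  fixes mem :: "'v \<Rightarrow> 'v \<Rightarrow> bool" (infix "\<^bold>\<in>" 50)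
begin

definition subset :: "'v \<Rightarrow> 'v \<Rightarrow> bool" (infix "\<^bold>\<subseteq>" 50) where
  "A \<^bold>\<subseteq> B \<longleftrightarrow> (\<forall>z. z \<^bold>\<in> A \<longrightarrow> z \<^bold>\<in> B)"

definition is_empty :: "'v \<Rightarrow> bool" where
  "is_empty A \<longleftrightarrow> (\<forall>z. \<not> z \<^bold>\<in> A)"

definition is_upair :: "'v \<Rightarrow> 'v \<Rightarrow> 'v \<Rightarrow> bool" where
  "is_upair p a b \<longleftrightarrow> (\<forall>z. z \<^bold>\<in> p \<longleftrightarrow> z = a \<or> z = b)"

definition is_Union :: "'v \<Rightarrow> 'v \<Rightarrow> bool" where
  "is_Union u S \<longleftrightarrow> (\<forall>z. z \<^bold>\<in> u \<longleftrightarrow> (\<exists>A. A \<^bold>\<in> S \<and> z \<^bold>\<in> A))"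

definition is_Pow :: "'v \<Rightarrow> 'v \<Rightarrow> bool" where
  "is_Pow P A \<longleftrightarrow> (\<forall>B. B \<^bold>\<in> P \<longleftrightarrow> B \<^bold>\<subseteq> A)"

definition is_inter :: "'v \<Rightarrow> 'v \<Rightarrow> 'v \<Rightarrow> bool" where
  "is_inter C A B \<longleftrightarrow> (\<forall>z. z \<^bold>\<in> C \<longleftrightarrow> z \<^bold>\<in> A \<and> z \<^bold>\<in> B)"

definition is_diff :: "'v \<Rightarrow> 'v \<Rightarrow> 'v \<Rightarrow> bool" where
  "is_diff C A B \<longleftrightarrow> (\<forall>z. z \<^bold>\<in> C \<longleftrightarrow> z \<^bold>\<in> A \<and> \<not> z \<^bold>\<in> B)"

text \<open>Kuratowski pairs \<open>{{a}, {a, b}}\<close>\<close>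

definition is_pair :: "'v \<Rightarrow> 'v \<Rightarrow> 'v \<Rightarrow> bool" where
  "is_pair p a b \<longleftrightarrow> (\<exists>u v. is_upair u a a \<and> is_upair v a b \<and> is_upair p u v)"

definition app :: "'v \<Rightarrow> 'v \<Rightarrow> 'v \<Rightarrow> bool" where
  "app f a b \<longleftrightarrow> (\<exists>p. is_pair p a b \<and> p \<^bold>\<in> f)"

definition is_function :: "'v \<Rightarrow> 'v \<Rightarrow> 'v \<Rightarrow> bool" where
  "is_function f A B \<longleftrightarrow>
     (\<forall>p. p \<^bold>\<in> f \<longrightarrow> (\<exists>a b. a \<^bold>\<in> A \<and> b \<^bold>\<in> B \<and> is_pair p a b)) \<and>
     (\<forall>a. a \<^bold>\<in> A \<longrightarrow> (\<exists>!b. app f a b))"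

definition is_bijection :: "'v \<Rightarrow> 'v \<Rightarrow> 'v \<Rightarrow> bool" where
  "is_bijection f A B \<longleftrightarrow> is_function f A B \<and> (\<forall>b. b \<^bold>\<in> B \<longrightarrow> (\<exists>!a. app f a b))"

definition is_preimage :: "'v \<Rightarrow> 'v \<Rightarrow> 'v \<Rightarrow> 'v \<Rightarrow> bool" where
  "is_preimage W f A V \<longleftrightarrow> (\<forall>a. a \<^bold>\<in> W \<longleftrightarrow> a \<^bold>\<in> A \<and> (\<exists>b. b \<^bold>\<in> V \<and> app f a b))"

definition is_succ :: "'v \<Rightarrow> 'v \<Rightarrow> bool" where
  "is_succ y x \<longleftrightarrow> (\<forall>z. z \<^bold>\<in> y \<longleftrightarrow> z \<^bold>\<in> x \<or> z = x)"

definition is_inductive :: "'v \<Rightarrow> bool" where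
  "is_inductive I \<longleftrightarrow>
     (\<exists>e. is_empty e \<and> e \<^bold>\<in> I) \<and> (\<forall>x. x \<^bold>\<in> I \<longrightarrow> (\<exists>y. is_succ y x \<and> y \<^bold>\<in> I))"

definition is_omega :: "'v \<Rightarrow> bool" where
  "is_omega w \<longleftrightarrow> is_inductive w \<and> (\<forall>I. is_inductive I \<longrightarrow> w \<^bold>\<subseteq> I)"

definition is_countable :: "'v \<Rightarrow> bool" where
  "is_countable H \<longleftrightarrow> (\<exists>w B f. is_omega w \<and> B \<^bold>\<subseteq> w \<and> is_bijection f H B)"

section \<open>Topological notions\<close>

text \<open>A space is given by its underlying set \<open>X\<close> and its family \<open>T\<close> of open sets.\<close>

definition topological_space :: "'v \<Rightarrow> 'v \<Rightarrow> bool" where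
  "topological_space X T \<longleftrightarrow>
     (\<forall>U. U \<^bold>\<in> T \<longrightarrow> U \<^bold>\<subseteq> X) \<and>
     (\<forall>e. is_empty e \<longrightarrow> e \<^bold>\<in> T) \<and>
     X \<^bold>\<in> T \<and>
     (\<forall>S u. S \<^bold>\<subseteq> T \<and> is_Union u S \<longrightarrow> u \<^bold>\<in> T) \<and>
     (\<forall>U V W. U \<^bold>\<in> T \<and> V \<^bold>\<in> T \<and> is_inter W U V \<longrightarrow> W \<^bold>\<in> T)"

definition closed_in :: "'v \<Rightarrow> 'v \<Rightarrow> 'v \<Rightarrow> bool" where
  "closed_in X T C \<longleftrightarrow> C \<^bold>\<subseteq> X \<and> (\<exists>D. is_diff D X C \<and> D \<^bold>\<in> T)"

definition clopen_in :: "'v \<Rightarrow> 'v \<Rightarrow> 'v \<Rightarrow> bool" where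
  "clopen_in X T C \<longleftrightarrow> C \<^bold>\<in> T \<and> closed_in X T C"

definition is_CO :: "'v \<Rightarrow> 'v \<Rightarrow> 'v \<Rightarrow> bool" where
  "is_CO B X T \<longleftrightarrow> (\<forall>C. C \<^bold>\<in> B \<longleftrightarrow> clopen_in X T C)"

definition is_base :: "'v \<Rightarrow> 'v \<Rightarrow> bool" where
  "is_base B T \<longleftrightarrow> B \<^bold>\<subseteq> T \<and> (\<forall>U. U \<^bold>\<in> T \<longrightarrow> (\<exists>S. S \<^bold>\<subseteq> B \<and> is_Union U S))"

definition zero_dimensional :: "'v \<Rightarrow> 'v \<Rightarrow> bool" where
  "zero_dimensional X T \<longleftrightarrow> (\<exists>B. is_CO B X T \<and> is_base B T)"

definition T1_space :: "'v \<Rightarrow> 'v \<Rightarrow> bool" where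
  "T1_space X T \<longleftrightarrow>
     (\<forall>x y. x \<^bold>\<in> X \<and> y \<^bold>\<in> X \<and> x \<noteq> y \<longrightarrow> (\<exists>U. U \<^bold>\<in> T \<and> x \<^bold>\<in> U \<and> \<not> y \<^bold>\<in> U))"

definition continuous_map :: "'v \<Rightarrow> 'v \<Rightarrow> 'v \<Rightarrow> 'v \<Rightarrow> 'v \<Rightarrow> bool" where
  "continuous_map f X T Y S \<longleftrightarrow>
     is_function f X Y \<and> (\<forall>V W. V \<^bold>\<in> S \<and> is_preimage W f X V \<longrightarrow> W \<^bold>\<in> T)"

definition homeomorphic :: "'v \<Rightarrow> 'v \<Rightarrow> 'v \<Rightarrow> 'v \<Rightarrow> bool" where
  "homeomorphic X T Y S \<longleftrightarrow>
     (\<exists>f g. is_bijection f X Y \<and> (\<forall>x y. app g y x \<longleftrightarrow> app f x y) \<and>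
        continuous_map f X T Y S \<and> continuous_map g Y S X T)"

definition is_subspace_topology :: "'v \<Rightarrow> 'v \<Rightarrow> 'v \<Rightarrow> bool" where
  "is_subspace_topology TC C T \<longleftrightarrow> (\<forall>W. W \<^bold>\<in> TC \<longleftrightarrow> (\<exists>V. V \<^bold>\<in> T \<and> is_inter W V C))"

text \<open>\<open>T\<close> contains the preimages of the open sets of \<open>(Y, S)\<close> under the projections
  \<open>z \<mapsto> z(j)\<close> of the set \<open>P\<close> of functions on \<open>J\<close>.\<close>

definition contains_subbasic :: "'v \<Rightarrow> 'v \<Rightarrow> 'v \<Rightarrow> 'v \<Rightarrow> bool" where
  "contains_subbasic T P S J \<longleftrightarrow>
     (\<forall>j V W. j \<^bold>\<in> J \<and> V \<^bold>\<in> S \<and>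
        (\<forall>z. z \<^bold>\<in> W \<longleftrightarrow> z \<^bold>\<in> P \<and> (\<exists>y. y \<^bold>\<in> V \<and> app z j y)) \<longrightarrow> W \<^bold>\<in> T)"

text \<open>\<open>(P, T)\<close> is the power of the space \<open>(Y, S)\<close> with exponent \<open>J\<close> with the product topology,
  i.e. the coarsest topology making all projections continuous.\<close>

definition is_power_space :: "'v \<Rightarrow> 'v \<Rightarrow> 'v \<Rightarrow> 'v \<Rightarrow> 'v \<Rightarrow> bool" where
  "is_power_space P T Y S J \<longleftrightarrow>
     (\<forall>z. z \<^bold>\<in> P \<longleftrightarrow> is_function z J Y) \<and>
     topological_space P T \<and> contains_subbasic T P S J \<and>
     (\<forall>T'. topological_space P T' \<and> contains_subbasic T' P S J \<longrightarrow> T \<^bold>\<subseteq> T')"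

definition N_compact :: "'v \<Rightarrow> 'v \<Rightarrow> bool" where
  "N_compact X T \<longleftrightarrow>
     (\<exists>w D J P TP C TC.
        is_omega w \<and> is_Pow D w \<and> \<not> is_empty J \<and> is_power_space P TP w D J \<and>
        closed_in P TP C \<and> is_subspace_topology TC C TP \<and> homeomorphic X T C TC)"

section \<open>Clopen filters\<close>

definition clopen_filter :: "'v \<Rightarrow> 'v \<Rightarrow> 'v \<Rightarrow> bool" where
  "clopen_filter X T F \<longleftrightarrow>
     (\<forall>A. A \<^bold>\<in> F \<longrightarrow> clopen_in X T A) \<and>
     \<not> is_empty F \<and>
     (\<forall>A. A \<^bold>\<in> F \<longrightarrow> \<not> is_empty A) \<and>
     (\<forall>A B C. A \<^bold>\<in> F \<and> B \<^bold>\<in> F \<and> is_inter C A B \<longrightarrow> C \<^bold>\<in> F) \<and>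
     (\<forall>A B. A \<^bold>\<in> F \<and> A \<^bold>\<subseteq> B \<and> clopen_in X T B \<longrightarrow> B \<^bold>\<in> F)"

definition clopen_ultrafilter :: "'v \<Rightarrow> 'v \<Rightarrow> 'v \<Rightarrow> bool" where
  "clopen_ultrafilter X T F \<longleftrightarrow>
     clopen_filter X T F \<and> (\<forall>G. clopen_filter X T G \<and> F \<^bold>\<subseteq> G \<longrightarrow> G = F)"

text \<open>For a non-empty family \<open>F\<close>, this is \<open>\<Inter>F \<noteq> \<emptyset>\<close>.\<close>

definition fixed_family :: "'v \<Rightarrow> bool" where
  "fixed_family F \<longleftrightarrow> (\<exists>x. \<forall>A. A \<^bold>\<in> F \<longrightarrow> x \<^bold>\<in> A)"

definition countable_intersection_property :: "'v \<Rightarrow> bool" where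
  "countable_intersection_property F \<longleftrightarrow>
     (\<forall>H. H \<^bold>\<subseteq> F \<and> \<not> is_empty H \<and> is_countable H \<longrightarrow> fixed_family H)"

end

section \<open>Models of ZF\<close>

locale ZF_model = set_structure mem for mem :: "'v \<Rightarrow> 'v \<Rightarrow> bool" (infix "\<^bold>\<in>" 50) +
  assumes extensionality: "\<forall>x y. (\<forall>z. z \<^bold>\<in> x \<longleftrightarrow> z \<^bold>\<in> y) \<longrightarrow> x = y"
    and foundation: "\<forall>x. (\<exists>y. y \<^bold>\<in> x) \<longrightarrow> (\<exists>y. y \<^bold>\<in> x \<and> \<not> (\<exists>z. z \<^bold>\<in> x \<and> z \<^bold>\<in> y))"
    and pairing: "\<forall>a b. \<exists>p. is_upair p a b"
    and union: "\<forall>S. \<exists>u. is_Union u S"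
    and powerset: "\<forall>A. \<exists>P. is_Pow P A"
    and infinity: "\<exists>I. is_inductive I"
    and separation:
      "\<forall>p s A. \<exists>B. \<forall>z. z \<^bold>\<in> B \<longleftrightarrow> z \<^bold>\<in> A \<and> sat (\<^bold>\<in>) p (case_nat z s)"
    and replacement:
      "\<forall>p s A.
         (\<forall>x y y'. x \<^bold>\<in> A \<and> sat (\<^bold>\<in>) p (case_nat x (case_nat y s)) \<and>
            sat (\<^bold>\<in>) p (case_nat x (case_nat y' s)) \<longrightarrow> y = y') \<longrightarrow>
         (\<exists>B. \<forall>y. y \<^bold>\<in> B \<longleftrightarrow> (\<exists>x. x \<^bold>\<in> A \<and> sat (\<^bold>\<in>) p (case_nat x (case_nat y s))))"

end

theory Submission
  imports Defs
begin

text \<open>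
  Inside a model of ZF every construction must be backed by a first-order formula. The predicates
  and operations in use are therefore shown to be \<^emph>\<open>definable\<close> with parameters. The class of
  definable predicates is closed under the connectives and quantifiers, and the class of definable
  terms contains variables, parameters, comprehensions, function values and \<open>\<lambda>\<close>-abstractions, so
  definability is proved by following the syntax (\<open>definable_rules\<close>). After that, separation and
  replacement act as comprehension for definable HOL predicates and functions, and the argument
  can be written as in ordinary mathematics.

  \<^emph>\<open>N-compact spaces.\<close> Let \<open>h\<close> be a homeomorphism from \<open>X\<close> onto a closed \<open>C \<subseteq> \<omega>\<^sup>J\<close> and \<open>F\<close> a clopen
  ultrafilter with the countable intersection property. For every \<open>j\<close> the fibers of \<open>x \<mapsto> h(x)(j)\<close>
  form a countable clopen partition of \<open>X\<close>. Were none of them in \<open>F\<close>, their complements would be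
  countably many members of \<open>F\<close> with empty intersection; so exactly one value \<open>p(j)\<close> has its fiber
  in \<open>F\<close> (\<open>ultrafilter_fiber\<close>). Uniqueness defines \<open>p \<in> \<omega>\<^sup>J\<close> without any choice.
  Every neighbourhood of \<open>p\<close> contains the image of a member of \<open>F\<close>; hence \<open>p \<in> C\<close>, and the point
  of \<open>X\<close> corresponding to \<open>p\<close> lies in every member of \<open>F\<close> (\<open>N_compact_imp_fixed\<close>).

  \<^emph>\<open>Fixed ultrafilters.\<close> Let \<open>J\<close> be the set of all continuous \<open>f : X \<rightarrow> \<omega>\<close>. Evaluation
  \<open>x \<mapsto> (f(x))\<^sub>f\<close> embeds \<open>X\<close> into \<open>\<omega>\<^sup>J\<close>, because indicator functions of clopen sets belong to \<open>J\<close>.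
  For \<open>p\<close> in the closure of the image, the clopen sets \<open>A\<close> with \<open>p(\<chi>\<^sub>A) = 1\<close> form a clopen
  ultrafilter, since any three coordinates of \<open>p\<close> agree with those of some point. It has
  the countable intersection property: if clopen sets \<open>A\<^sub>n\<close> have empty intersection, then
  \<open>g(x) = min {n. x \<notin> A\<^sub>n}\<close> is in \<open>J\<close>, and a point at which \<open>g\<close> and the indicator of \<open>A\<^sub>n\<close> for
  \<open>n = p(g)\<close> agree with \<open>p\<close> is outside \<open>A\<^sub>n\<close>, so \<open>A\<^sub>n\<close> is not in the ultrafilter
  (\<open>separating_function\<close>, \<open>closure_point_ultrafilter\<close>). A point fixing this ultrafilter is mapped
  to \<open>p\<close>, so the image is closed (\<open>fixed_imp_N_compact\<close>).

  The product topology is handled through its minimality: a property of all open sets of a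
  power is proved by checking that the sets with the property form a topology containing the
  subbasic ones. This avoids speaking of finite sets, whose size may be a nonstandard number of
  the model.
\<close>

section \<open>Definability with parameters\<close>

primrec rename :: "(nat \<Rightarrow> nat) \<Rightarrow> fm \<Rightarrow> fm" where
  "rename f (Member i j) = Member (f i) (f j)"
| "rename f (Equal i j) = Equal (f i) (f j)"
| "rename f (Neg p) = Neg (rename f p)"
| "rename f (Conj p q) = Conj (rename f p) (rename f q)"
| "rename f (Forall p) = Forall (rename (case_nat 0 (\<lambda>n. Suc (f n))) p)"

lemma sat_rename: "sat mem (rename f p) s \<longleftrightarrow> sat mem p (\<lambda>n. s (f n))"
proof (induction p arbitrary: f s)
  case (Forall p)
  have "(\<lambda>n. case_nat a s (case_nat 0 (\<lambda>n. Suc (f n)) n)) = case_nat a (\<lambda>n. s (f n))" for a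
    by (auto simp: fun_eq_iff split: nat.split)
  with Forall show ?case by simp
qed auto

text \<open>Each free slot of a formula holds either a parameter (\<open>Inl\<close>) or a variable (\<open>Inr\<close>).\<close>

definition fill :: "(nat \<Rightarrow> 'v + nat) \<Rightarrow> (nat \<Rightarrow> 'v) \<Rightarrow> nat \<Rightarrow> 'v" where
  "fill g s n = (case g n of Inl c \<Rightarrow> c | Inr m \<Rightarrow> s m)"

context set_structure
begin

definition definable :: "((nat \<Rightarrow> 'v) \<Rightarrow> bool) \<Rightarrow> bool" where
  "definable Q \<longleftrightarrow> (\<exists>p g. \<forall>s. Q s \<longleftrightarrow> sat (\<^bold>\<in>) p (fill g s))"

text \<open>A term is definable if its graph is; variable 0 stands for the value and the arguments of the
  term are shifted by one.\<close>

definition definable_term :: "((nat \<Rightarrow> 'v) \<Rightarrow> 'v) \<Rightarrow> bool" where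
  "definable_term t \<longleftrightarrow> definable (\<lambda>s. s 0 = t (\<lambda>n. s (Suc n)))"

named_theorems definable_rules

lemma definableI: "(\<And>s. Q s \<longleftrightarrow> sat (\<^bold>\<in>) p (fill g s)) \<Longrightarrow> definable Q"
  unfolding definable_def by blast

text \<open>
  The following rules descend along the syntax
  of the expression. Under a binder the bound variable becomes \<open>s 0\<close> and the index of every other
  variable goes up by one, as in de Bruijn notation; every subterm that does not depend on \<open>s\<close> is a
  parameter.
\<close>

lemma definable_mem_var: "definable (\<lambda>s. s i \<^bold>\<in> s j)"
  by (rule definableI[of _ "Member 0 1" "case_nat (Inr i) (\<lambda>_. Inr j)"]) (simp add: fill_def)

lemma definable_eq_var: "definable (\<lambda>s. s i = s j)"
  by (rule definableI[of _ "Equal 0 1" "case_nat (Inr i) (\<lambda>_. Inr j)"]) (simp add: fill_def)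

lemma definable_not [definable_rules]: "definable P \<Longrightarrow> definable (\<lambda>s. \<not> P s)"
proof -
  assume "definable P"
  then obtain p g where "\<And>s. P s \<longleftrightarrow> sat (\<^bold>\<in>) p (fill g s)"
    unfolding definable_def by blast
  then show ?thesis by (intro definableI[of _ "Neg p" g]) simp
qed

lemma definable_and [definable_rules]:
  assumes "definable P" "definable Q" shows "definable (\<lambda>s. P s \<and> Q s)"
proof -
  obtain p g where p: "\<And>s. P s \<longleftrightarrow> sat (\<^bold>\<in>) p (fill g s)"
    using assms(1) unfolding definable_def by blast
  obtain q h where q: "\<And>s. Q s \<longleftrightarrow> sat (\<^bold>\<in>) q (fill h s)"
    using assms(2) unfolding definable_def by blast
  \<comment> \<open>The slots of \<open>p\<close> move to even positions and those of \<open>q\<close> to odd ones.\<close>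
  define k where "k n = (if even n then g (n div 2) else h (n div 2))" for n
  have "fill k s (2 * n) = fill g s n" "fill k s (2 * n + 1) = fill h s n" for s n
    by (simp_all add: fill_def k_def)
  then show ?thesis
    by (intro definableI[of _ "Conj (rename (\<lambda>n. 2 * n) p) (rename (\<lambda>n. 2 * n + 1) q)" k])
      (simp add: sat_rename p q)
qed

lemma definable_or [definable_rules]:
  assumes "definable P" "definable Q" shows "definable (\<lambda>s. P s \<or> Q s)"
proof -
  have "definable (\<lambda>s. \<not> (\<not> P s \<and> \<not> Q s))"
    by (intro definable_not definable_and assms)
  then show ?thesis by simp
qed

lemma definable_imp [definable_rules]:
  assumes "definable P" "definable Q" shows "definable (\<lambda>s. P s \<longrightarrow> Q s)"
  unfolding imp_conv_disj by (intro definable_or definable_not assms)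

lemma definable_iff [definable_rules]:
  assumes "definable P" "definable Q" shows "definable (\<lambda>s. P s \<longleftrightarrow> Q s)"
  unfolding iff_conv_conj_imp by (intro definable_and definable_imp assms)

lemma definable_rename: "definable P \<Longrightarrow> definable (\<lambda>s. P (\<lambda>n. s (f n)))"
proof -
  assume "definable P"
  then obtain p g where p: "\<And>s. P s \<longleftrightarrow> sat (\<^bold>\<in>) p (fill g s)"
    unfolding definable_def by blast
  have "fill (\<lambda>n. map_sum id f (g n)) s = fill g (\<lambda>n. s (f n))" for s
    by (auto simp: fill_def fun_eq_iff split: sum.split)
  then show ?thesis
    by (intro definableI[of _ p "\<lambda>n. map_sum id f (g n)"]) (simp add: p)
qed

text \<open>
  The axiom schemes test a formula in an environment of the form \<open>case_nat x s\<close>, with the tested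
  element at index 0. All slots that refer to variable 0 are merged into that index, and everything
  else is moved into the remaining environment.
\<close>

lemma definable_fiber:
  assumes "definable P"
  obtains p g where "\<And>x s. P (case_nat x s) \<longleftrightarrow> sat (\<^bold>\<in>) p (case_nat x (fill g s))"
proof -
  obtain p g where p: "\<And>s. P s \<longleftrightarrow> sat (\<^bold>\<in>) p (fill g s)"
    using assms unfolding definable_def by blast
  define r where "r n = (if g n = Inr 0 then 0 else Suc n)" for n
  define h where "h n = map_sum id (\<lambda>m. m - 1) (g n)" for n
  have "(\<lambda>n. case_nat x (fill h s) (r n)) = fill g (case_nat x s)" for x s
    by (auto simp: fun_eq_iff r_def h_def fill_def split: nat.split sum.split)
  then have "P (case_nat x s) \<longleftrightarrow> sat (\<^bold>\<in>) (rename r p) (case_nat x (fill h s))" for x s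
    by (simp add: p sat_rename)
  then show thesis by (rule that)
qed

lemma definable_fiber2:
  assumes "definable P"
  obtains p g where
    "\<And>x y s. P (case_nat x (case_nat y s)) \<longleftrightarrow> sat (\<^bold>\<in>) p (case_nat x (case_nat y (fill g s)))"
proof -
  obtain p g where p: "\<And>x s. P (case_nat x s) \<longleftrightarrow> sat (\<^bold>\<in>) p (case_nat x (fill g s))"
    by (rule definable_fiber[OF assms]) auto
  define r where "r = case_nat 0 (\<lambda>n. if g n = Inr 0 then 1 else Suc (Suc n))"
  define h where "h n = map_sum id (\<lambda>m. m - 1) (g n)" for n
  have "(\<lambda>n. case_nat x (case_nat y (fill h s)) (r n)) = case_nat x (fill g (case_nat y s))" for x y s
    by (auto simp: fun_eq_iff r_def h_def fill_def split: nat.split sum.split)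
  then have "P (case_nat x (case_nat y s)) \<longleftrightarrow>
      sat (\<^bold>\<in>) (rename r p) (case_nat x (case_nat y (fill h s)))" for x y s
    by (simp add: p sat_rename)
  then show thesis by (rule that)
qed

lemma definable_all [definable_rules]:
  assumes "definable (\<lambda>s. P (\<lambda>n. s (Suc n)) (s 0))"
  shows "definable (\<lambda>s. \<forall>x. P s x)"
proof -
  obtain p g where "\<And>x s. P s x \<longleftrightarrow> sat (\<^bold>\<in>) p (case_nat x (fill g s))"
    by (rule definable_fiber[OF assms]) auto
  then show ?thesis by (intro definableI[of _ "Forall p" g]) simp
qed

lemma definable_ex [definable_rules]:
  assumes "definable (\<lambda>s. P (\<lambda>n. s (Suc n)) (s 0))"
  shows "definable (\<lambda>s. \<exists>x. P s x)"
proof -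
  have "definable (\<lambda>s. \<not> (\<forall>x. \<not> P s x))"
    by (intro definable_not definable_all assms)
  then show ?thesis by simp
qed

lemma definable_term_var [definable_rules]: "definable_term (\<lambda>s. s i)"
  unfolding definable_term_def by (rule definable_eq_var)

lemma definable_term_const [definable_rules]: "definable_term (\<lambda>s. c)"
  unfolding definable_term_def
  by (rule definableI[of _ "Equal 0 1" "case_nat (Inr 0) (\<lambda>_. Inl c)"]) (simp add: fill_def)

lemma definable_term_rename:
  assumes "definable_term t" shows "definable_term (\<lambda>s. t (\<lambda>n. s (f n)))"
  using definable_rename[OF assms[unfolded definable_term_def], of "case_nat 0 (\<lambda>n. Suc (f n))"]
  by (simp add: definable_term_def)

lemma definable_graph:
  assumes "definable_term t" shows "definable (\<lambda>s. s i = t (\<lambda>n. s (f n)))"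
  using definable_rename[OF assms[unfolded definable_term_def], of "case_nat i f"] by simp

text \<open>A term may be substituted for a variable because \<open>R (t s) (u s)\<close> can be expressed by quantifying
  over the values of \<open>t\<close> and \<open>u\<close>, using only their graphs.\<close>

lemma definable_comp2:
  assumes "definable (\<lambda>s. R (s 0) (s 1))" "definable_term t" "definable_term u"
  shows "definable (\<lambda>s. R (t s) (u s))"
proof -
  have "definable (\<lambda>s. \<exists>y x. x = t s \<and> y = u s \<and> R x y)"
    by (intro definable_ex definable_and definable_graph[OF assms(2)] definable_graph[OF assms(3)])
      (use assms(1) in simp)
  then show ?thesis by simp
qed

lemma definable_mem [definable_rules]:
  "definable_term t \<Longrightarrow> definable_term u \<Longrightarrow> definable (\<lambda>s. t s \<^bold>\<in> u s)"
  by (rule definable_comp2[where R = "(\<^bold>\<in>)"]) (rule definable_mem_var)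

lemma definable_eq [definable_rules]:
  "definable_term t \<Longrightarrow> definable_term u \<Longrightarrow> definable (\<lambda>s. t s = u s)"
  by (rule definable_comp2[where R = "(=)"]) (rule definable_eq_var)

lemma definable_ex1 [definable_rules]:
  assumes "definable (\<lambda>s. P (\<lambda>n. s (Suc n)) (s 0))"
  shows "definable (\<lambda>s. \<exists>!x. P s x)"
proof -
  have "definable (\<lambda>s. P (\<lambda>n. s (Suc (Suc n))) (s 0))"
    using definable_rename[OF assms, of "case_nat 0 (\<lambda>n. Suc (Suc n))"] by simp
  then show ?thesis
    unfolding Ex1_def by (intro definable_rules assms)
qed

text \<open>
  Definite description with a fixed default. The value of \<open>THE\<close> is unspecified when there is no
  unique witness and may then depend on the predicate in an undefinable way; here it is a parameter,
  which makes descriptions definable unconditionally.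
\<close>

definition unique :: "('v \<Rightarrow> bool) \<Rightarrow> 'v" where
  "unique P = (if \<exists>!x. P x then THE x. P x else undefined)"

lemma unique_eqI: "P x \<Longrightarrow> (\<And>y. P y \<Longrightarrow> y = x) \<Longrightarrow> unique P = x"
  unfolding unique_def by (metis the_equality)

lemma unique_satisfies: "\<exists>!x. P x \<Longrightarrow> P (unique P)"
  unfolding unique_def by (simp add: theI')

lemma eq_unique_iff:
  "y = unique P \<longleftrightarrow> P y \<and> (\<exists>!x. P x) \<or> \<not> (\<exists>!x. P x) \<and> y = undefined"
proof (cases "\<exists>!x. P x")
  case True
  then obtain x where "P x" and x: "\<And>y. P y \<Longrightarrow> y = x" by blast
  then have "unique P = x" by (rule unique_eqI)
  moreover have "y = x \<longleftrightarrow> P y"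
    using \<open>P x\<close> x by blast
  ultimately show ?thesis using True by simp
next
  case False
  then show ?thesis unfolding unique_def by simp
qed

lemma definable_term_unique [definable_rules]:
  assumes "definable (\<lambda>s. P (\<lambda>n. s (Suc n)) (s 0))"
  shows "definable_term (\<lambda>s. unique (P s))"
proof -
  have "definable (\<lambda>s. \<exists>!x. P (\<lambda>n. s (Suc n)) x)"
    by (rule definable_rename[OF definable_ex1[OF assms]])
  then show ?thesis
    unfolding definable_term_def eq_unique_iff
    by (intro definable_or definable_and definable_not definable_eq definable_term_var
        definable_term_const assms)
qed

section \<open>Definable predicates and set operations\<close>

lemma definable_subset [definable_rules]:
  assumes "definable_term t" "definable_term u"
  shows "definable (\<lambda>s. t s \<^bold>\<subseteq> u s)"
  unfolding subset_def by (intro definable_rules assms assms[THEN definable_term_rename])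

text \<open>The set of all \<open>z\<close> with \<open>Q z\<close>, meaningful when the model contains this set.\<close>

definition coll :: "('v \<Rightarrow> bool) \<Rightarrow> 'v" where
  "coll Q = unique (\<lambda>B. \<forall>z. z \<^bold>\<in> B \<longleftrightarrow> Q z)"

lemma definable_term_coll [definable_rules]:
  assumes "definable (\<lambda>s. Q (\<lambda>n. s (Suc n)) (s 0))"
  shows "definable_term (\<lambda>s. coll (Q s))"
proof -
  have "definable (\<lambda>s. Q (\<lambda>n. s (Suc (Suc n))) (s 0))"
    using definable_rename[OF assms, of "case_nat 0 (\<lambda>n. Suc (Suc n))"] by simp
  then show ?thesis unfolding coll_def by (intro definable_rules)
qed

definition upair :: "'v \<Rightarrow> 'v \<Rightarrow> 'v" where
  "upair a b = coll (\<lambda>z. z = a \<or> z = b)"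

definition pair :: "'v \<Rightarrow> 'v \<Rightarrow> 'v" where
  "pair a b = upair (upair a a) (upair a b)"

definition Sing :: "'v \<Rightarrow> 'v" where
  "Sing a = upair a a"

definition sUnion :: "'v \<Rightarrow> 'v" where
  "sUnion S = coll (\<lambda>z. \<exists>A. A \<^bold>\<in> S \<and> z \<^bold>\<in> A)"

definition sPow :: "'v \<Rightarrow> 'v" where
  "sPow A = coll (\<lambda>B. B \<^bold>\<subseteq> A)"

definition sInter :: "'v \<Rightarrow> 'v \<Rightarrow> 'v" where
  "sInter A B = coll (\<lambda>z. z \<^bold>\<in> A \<and> z \<^bold>\<in> B)"

definition sDiff :: "'v \<Rightarrow> 'v \<Rightarrow> 'v" where
  "sDiff A B = coll (\<lambda>z. z \<^bold>\<in> A \<and> \<not> z \<^bold>\<in> B)"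

definition sSucc :: "'v \<Rightarrow> 'v" where
  "sSucc x = coll (\<lambda>z. z \<^bold>\<in> x \<or> z = x)"

definition repl :: "'v \<Rightarrow> ('v \<Rightarrow> 'v) \<Rightarrow> 'v" where
  "repl A F = coll (\<lambda>y. \<exists>x. x \<^bold>\<in> A \<and> y = F x)"

definition lam :: "'v \<Rightarrow> ('v \<Rightarrow> 'v) \<Rightarrow> 'v" where
  "lam A F = repl A (\<lambda>x. pair x (F x))"

definition val :: "'v \<Rightarrow> 'v \<Rightarrow> 'v" where
  "val f x = unique (\<lambda>y. pair x y \<^bold>\<in> f)"

lemma definable_term_upair [definable_rules]:
  assumes "definable_term t" "definable_term u"
  shows "definable_term (\<lambda>s. upair (t s) (u s))"
  unfolding upair_def by (intro definable_rules assms assms[THEN definable_term_rename])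

lemma definable_term_pair [definable_rules]:
  assumes "definable_term t" "definable_term u"
  shows "definable_term (\<lambda>s. pair (t s) (u s))"
  unfolding pair_def by (intro definable_rules assms)

lemma definable_term_sDiff [definable_rules]:
  assumes "definable_term t" "definable_term u"
  shows "definable_term (\<lambda>s. sDiff (t s) (u s))"
  unfolding sDiff_def by (intro definable_rules assms assms[THEN definable_term_rename])

lemma definable_term_sInter [definable_rules]:
  assumes "definable_term t" "definable_term u"
  shows "definable_term (\<lambda>s. sInter (t s) (u s))"
  unfolding sInter_def by (intro definable_rules assms assms[THEN definable_term_rename])

lemma definable_term_sSucc [definable_rules]:
  assumes "definable_term t" shows "definable_term (\<lambda>s. sSucc (t s))"
  unfolding sSucc_def by (intro definable_rules assms assms[THEN definable_term_rename])

lemma definable_term_repl [definable_rules]: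
  assumes "definable_term t" "definable_term (\<lambda>s. F (\<lambda>n. s (Suc n)) (s 0))"
  shows "definable_term (\<lambda>s. repl (t s) (F s))"
proof -
  have "definable_term (\<lambda>s. F (\<lambda>n. s (Suc (Suc n))) (s 0))"
    using definable_term_rename[OF assms(2), of "case_nat 0 (\<lambda>n. Suc (Suc n))"] by simp
  then show ?thesis
    unfolding repl_def by (intro definable_rules assms(1)[THEN definable_term_rename])
qed

lemma definable_term_lam [definable_rules]:
  assumes "definable_term t" "definable_term (\<lambda>s. F (\<lambda>n. s (Suc n)) (s 0))"
  shows "definable_term (\<lambda>s. lam (t s) (F s))"
  unfolding lam_def by (intro definable_rules assms)

lemma definable_term_val [definable_rules]:
  assumes "definable_term t" "definable_term u"
  shows "definable_term (\<lambda>s. val (t s) (u s))"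
  unfolding val_def by (intro definable_rules assms assms[THEN definable_term_rename])

lemma definable_term_if [definable_rules]:
  assumes "definable P" "definable_term t" "definable_term u"
  shows "definable_term (\<lambda>s. if P s then t s else u s)"
proof -
  have *: "(x = (if b then y else z)) \<longleftrightarrow> b \<and> x = y \<or> \<not> b \<and> x = z" for x y z :: 'v and b
    by simp
  show ?thesis
    unfolding definable_term_def *
    by (intro definable_rules assms(2-3)[THEN definable_term_rename] definable_rename[OF assms(1)])
qed

lemma definable_is_empty [definable_rules]:
  assumes "definable_term t" shows "definable (\<lambda>s. is_empty (t s))"
  unfolding is_empty_def by (intro definable_rules assms assms[THEN definable_term_rename])

lemma definable_is_upair [definable_rules]:
  assumes "definable_term t" "definable_term u" "definable_term v"
  shows "definable (\<lambda>s. is_upair (t s) (u s) (v s))"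
  unfolding is_upair_def by (intro definable_rules assms assms[THEN definable_term_rename])

lemma definable_is_pair [definable_rules]:
  assumes "definable_term t" "definable_term u" "definable_term v"
  shows "definable (\<lambda>s. is_pair (t s) (u s) (v s))"
  unfolding is_pair_def by (intro definable_rules assms assms[THEN definable_term_rename])

lemma definable_app [definable_rules]:
  assumes "definable_term t" "definable_term u" "definable_term v"
  shows "definable (\<lambda>s. app (t s) (u s) (v s))"
  unfolding app_def by (intro definable_rules assms assms[THEN definable_term_rename])

lemma definable_is_function [definable_rules]:
  assumes "definable_term t" "definable_term u" "definable_term v"
  shows "definable (\<lambda>s. is_function (t s) (u s) (v s))"
  unfolding is_function_def by (intro definable_rules assms assms[THEN definable_term_rename])

lemma definable_is_succ [definable_rules]:
  assumes "definable_term t" "definable_term u"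
  shows "definable (\<lambda>s. is_succ (t s) (u s))"
  unfolding is_succ_def by (intro definable_rules assms assms[THEN definable_term_rename])

lemma definable_is_inductive [definable_rules]:
  assumes "definable_term t" shows "definable (\<lambda>s. is_inductive (t s))"
  unfolding is_inductive_def by (intro definable_rules assms assms[THEN definable_term_rename])

lemma definable_is_Union [definable_rules]:
  assumes "definable_term t" "definable_term u"
  shows "definable (\<lambda>s. is_Union (t s) (u s))"
  unfolding is_Union_def by (intro definable_rules assms assms[THEN definable_term_rename])

lemma definable_is_inter [definable_rules]:
  assumes "definable_term t" "definable_term u" "definable_term v"
  shows "definable (\<lambda>s. is_inter (t s) (u s) (v s))"
  unfolding is_inter_def by (intro definable_rules assms assms[THEN definable_term_rename])

lemma definable_is_diff [definable_rules]:
  assumes "definable_term t" "definable_term u" "definable_term v"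
  shows "definable (\<lambda>s. is_diff (t s) (u s) (v s))"
  unfolding is_diff_def by (intro definable_rules assms assms[THEN definable_term_rename])

lemma definable_clopen_in [definable_rules]:
  assumes "definable_term t" "definable_term u" "definable_term v"
  shows "definable (\<lambda>s. clopen_in (t s) (u s) (v s))"
  unfolding clopen_in_def closed_in_def
  by (intro definable_rules assms assms[THEN definable_term_rename])

lemma definable_topological_space [definable_rules]:
  assumes "definable_term t" "definable_term u"
  shows "definable (\<lambda>s. topological_space (t s) (u s))"
  unfolding topological_space_def
  by (intro definable_rules assms assms[THEN definable_term_rename])

lemma definable_contains_subbasic [definable_rules]:
  assumes "definable_term t" "definable_term u" "definable_term v" "definable_term w"
  shows "definable (\<lambda>s. contains_subbasic (t s) (u s) (v s) (w s))"
  unfolding contains_subbasic_def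
  by (intro definable_rules assms assms[THEN definable_term_rename])

end

section \<open>Sets in a model\<close>

context ZF_model
begin

lemma ext: "(\<And>z. z \<^bold>\<in> x \<longleftrightarrow> z \<^bold>\<in> y) \<Longrightarrow> x = y"
  using extensionality by blast

lemma eq_iff_mem: "(\<And>z. z \<^bold>\<in> B \<longleftrightarrow> Q z) \<Longrightarrow> (\<forall>z. z \<^bold>\<in> A \<longleftrightarrow> Q z) \<longleftrightarrow> A = B"
  using ext[of A B] by auto

lemma mem_coll_ex:
  assumes "\<forall>z. z \<^bold>\<in> B \<longleftrightarrow> Q z"
  shows "coll Q = B" "x \<^bold>\<in> coll Q \<longleftrightarrow> Q x"
proof -
  show *: "coll Q = B"
    unfolding coll_def by (rule unique_eqI) (use assms in \<open>auto intro: ext\<close>)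
  show "x \<^bold>\<in> coll Q \<longleftrightarrow> Q x" using assms * by simp
qed

text \<open>Separation for a comprehension whose bound is implicit: \<open>A\<close> may be any set known to contain all
  witnesses of \<open>Q\<close>.\<close>

lemma mem_coll_subset:
  assumes "definable (\<lambda>s. Q (s 0))" "\<And>x. Q x \<Longrightarrow> x \<^bold>\<in> A"
  shows "x \<^bold>\<in> coll Q \<longleftrightarrow> Q x"
proof -
  obtain p g where p: "\<And>x s. Q x \<longleftrightarrow> sat (\<^bold>\<in>) p (case_nat x (fill g s))"
    by (rule definable_fiber[OF assms(1)]) auto
  obtain B where "\<forall>z. z \<^bold>\<in> B \<longleftrightarrow> z \<^bold>\<in> A \<and> sat (\<^bold>\<in>) p (case_nat z (fill g undefined))"
    using separation by blast
  then have "\<forall>z. z \<^bold>\<in> B \<longleftrightarrow> Q z"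
    using assms(2) p by blast
  then show ?thesis by (rule mem_coll_ex)
qed

lemma mem_sep:
  assumes "definable (\<lambda>s. Q (s 0))"
  shows "x \<^bold>\<in> coll (\<lambda>z. z \<^bold>\<in> A \<and> Q z) \<longleftrightarrow> x \<^bold>\<in> A \<and> Q x"
  by (rule mem_coll_subset[where A = A]) (intro definable_rules assms, simp)

lemma mem_upair [simp]: "x \<^bold>\<in> upair a b \<longleftrightarrow> x = a \<or> x = b"
proof -
  obtain p where "is_upair p a b" using pairing by blast
  then show ?thesis unfolding upair_def is_upair_def by (rule mem_coll_ex)
qed

lemma mem_Sing [simp]: "x \<^bold>\<in> Sing a \<longleftrightarrow> x = a"
  by (simp add: Sing_def)

lemma mem_sUnion [simp]: "x \<^bold>\<in> sUnion S \<longleftrightarrow> (\<exists>A. A \<^bold>\<in> S \<and> x \<^bold>\<in> A)"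
proof -
  obtain u where "is_Union u S" using union by blast
  then show ?thesis unfolding sUnion_def is_Union_def by (rule mem_coll_ex)
qed

lemma mem_sPow [simp]: "x \<^bold>\<in> sPow A \<longleftrightarrow> x \<^bold>\<subseteq> A"
proof -
  obtain u where "is_Pow u A" using powerset by blast
  then show ?thesis unfolding sPow_def is_Pow_def by (rule mem_coll_ex)
qed

lemma mem_sInter [simp]: "x \<^bold>\<in> sInter A B \<longleftrightarrow> x \<^bold>\<in> A \<and> x \<^bold>\<in> B"
  unfolding sInter_def by (rule mem_sep) (intro definable_rules)

lemma mem_sDiff [simp]: "x \<^bold>\<in> sDiff A B \<longleftrightarrow> x \<^bold>\<in> A \<and> \<not> x \<^bold>\<in> B"
  unfolding sDiff_def by (rule mem_sep) (intro definable_rules)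

lemma mem_sSucc [simp]: "x \<^bold>\<in> sSucc y \<longleftrightarrow> x \<^bold>\<in> y \<or> x = y"
  unfolding sSucc_def
proof (rule mem_coll_ex(2)[of "sUnion (upair y (Sing y))"])
  show "\<forall>z. z \<^bold>\<in> sUnion (upair y (Sing y)) \<longleftrightarrow> z \<^bold>\<in> y \<or> z = y" by auto
qed

lemma mem_repl:
  assumes "definable_term (\<lambda>s. F (s 0))"
  shows "y \<^bold>\<in> repl A F \<longleftrightarrow> (\<exists>x. x \<^bold>\<in> A \<and> y = F x)"
proof -
  have "definable (\<lambda>s. s (Suc 0) = F (s 0))"
    using definable_graph[OF assms, of "Suc 0" "\<lambda>_. 0"] by simp
  then obtain p g where p: "\<And>x y s. y = F x \<longleftrightarrow> sat (\<^bold>\<in>) p (case_nat x (case_nat y (fill g s)))"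
    by (rule definable_fiber2) auto
  obtain B where "\<forall>y. y \<^bold>\<in> B \<longleftrightarrow>
    (\<exists>x. x \<^bold>\<in> A \<and> sat (\<^bold>\<in>) p (case_nat x (case_nat y (fill g undefined))))"
    using replacement[rule_format, of A p "fill g undefined"] p[symmetric] by auto
  then have "\<forall>y. y \<^bold>\<in> B \<longleftrightarrow> (\<exists>x. x \<^bold>\<in> A \<and> y = F x)"
    using p by blast
  then show ?thesis unfolding repl_def by (rule mem_coll_ex)
qed

lemma is_upair_iff: "is_upair p a b \<longleftrightarrow> p = upair a b"
  unfolding is_upair_def by (auto intro: ext)

lemma is_Union_iff: "is_Union u S \<longleftrightarrow> u = sUnion S"
  unfolding is_Union_def by (auto intro: ext)

lemma is_Pow_iff: "is_Pow u S \<longleftrightarrow> u = sPow S"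
  unfolding is_Pow_def by (auto intro: ext)

lemma is_inter_iff: "is_inter u A B \<longleftrightarrow> u = sInter A B"
  unfolding is_inter_def by (auto intro: ext)

lemma is_diff_iff: "is_diff u A B \<longleftrightarrow> u = sDiff A B"
  unfolding is_diff_def by (auto intro: ext)

lemma is_succ_iff: "is_succ u A \<longleftrightarrow> u = sSucc A"
  unfolding is_succ_def by (auto intro: ext)

lemma is_pair_iff: "is_pair p a b \<longleftrightarrow> p = pair a b"
  unfolding is_pair_def pair_def is_upair_iff by simp

lemma upair_eq_iff: "upair a b = upair c d \<longleftrightarrow> a = c \<and> b = d \<or> a = d \<and> b = c"
proof
  assume "upair a b = upair c d"
  then have "z = a \<or> z = b \<longleftrightarrow> z = c \<or> z = d" for z by (metis mem_upair)
  then show "a = c \<and> b = d \<or> a = d \<and> b = c" by metis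
qed (auto intro: ext)

lemma pair_eq_iff [simp]: "pair a b = pair c d \<longleftrightarrow> a = c \<and> b = d"
  unfolding pair_def upair_eq_iff by auto

lemma app_iff: "app f a b \<longleftrightarrow> pair a b \<^bold>\<in> f"
  unfolding app_def is_pair_iff by simp

section \<open>Functions\<close>

lemma app_function_iff:
  assumes "is_function f A B"
  shows "app f x y \<longleftrightarrow> x \<^bold>\<in> A \<and> y = val f x"
proof -
  have "\<exists>!y. app f x y" if "x \<^bold>\<in> A"
    using assms that unfolding is_function_def by blast
  then have "app f x (val f x) \<and> (app f x y \<longrightarrow> y = val f x)" if "x \<^bold>\<in> A"
    using that unfolding val_def app_iff by (metis unique_eqI)
  moreover have "x \<^bold>\<in> A" if "app f x y"
    using assms that unfolding is_function_def is_pair_iff app_iff by (metis pair_eq_iff)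
  ultimately show ?thesis by blast
qed

lemma val_in_codomain:
  assumes "is_function f A B" "x \<^bold>\<in> A"
  shows "val f x \<^bold>\<in> B"
proof -
  have "pair x (val f x) \<^bold>\<in> f"
    using app_function_iff[OF assms(1)] assms(2) by (simp add: app_iff)
  then show ?thesis
    using assms(1) unfolding is_function_def is_pair_iff by (metis pair_eq_iff)
qed

lemma mem_function_iff:
  assumes "is_function f A B"
  shows "p \<^bold>\<in> f \<longleftrightarrow> (\<exists>x. x \<^bold>\<in> A \<and> p = pair x (val f x))"
proof
  assume "p \<^bold>\<in> f"
  moreover from this obtain a b where "p = pair a b"
    using assms unfolding is_function_def is_pair_iff by metis
  ultimately show "\<exists>x. x \<^bold>\<in> A \<and> p = pair x (val f x)"
    using app_function_iff[OF assms, of a b] by (auto simp: app_iff)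
next
  assume "\<exists>x. x \<^bold>\<in> A \<and> p = pair x (val f x)"
  then show "p \<^bold>\<in> f"
    using app_function_iff[OF assms] by (auto simp: app_iff)
qed

lemma function_eqI:
  assumes "is_function f A B" "is_function g A C" "\<And>x. x \<^bold>\<in> A \<Longrightarrow> val f x = val g x"
  shows "f = g"
  by (rule ext) (use assms(3) in \<open>auto simp: mem_function_iff[OF assms(1)] mem_function_iff[OF assms(2)]\<close>)

lemma app_lam:
  assumes "definable_term (\<lambda>s. F (s 0))"
  shows "app (lam A F) x y \<longleftrightarrow> x \<^bold>\<in> A \<and> y = F x"
  unfolding app_iff lam_def by (subst mem_repl) (intro definable_rules assms, auto)

lemma lam_function:
  assumes "definable_term (\<lambda>s. F (s 0))" "\<And>x. x \<^bold>\<in> A \<Longrightarrow> F x \<^bold>\<in> B"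
  shows "is_function (lam A F) A B"
proof -
  have "p \<^bold>\<in> lam A F \<longleftrightarrow> (\<exists>x. x \<^bold>\<in> A \<and> p = pair x (F x))" for p
    unfolding lam_def by (rule mem_repl) (intro definable_rules assms)
  then show ?thesis
    unfolding is_function_def app_lam[OF assms(1)] is_pair_iff using assms(2) by auto
qed

lemma val_lam:
  assumes "definable_term (\<lambda>s. F (s 0))" "x \<^bold>\<in> A"
  shows "val (lam A F) x = F x"
  unfolding val_def using app_lam[OF assms(1)] assms(2)
  by (intro unique_eqI) (auto simp: app_iff)

definition prod_set :: "'v \<Rightarrow> 'v \<Rightarrow> 'v" where
  "prod_set A B = sUnion (repl A (\<lambda>a. repl B (\<lambda>b. pair a b)))"

lemma mem_prod_set: "p \<^bold>\<in> prod_set A B \<longleftrightarrow> (\<exists>a b. a \<^bold>\<in> A \<and> b \<^bold>\<in> B \<and> p = pair a b)"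
proof -
  have "y \<^bold>\<in> repl B (\<lambda>b. pair a b) \<longleftrightarrow> (\<exists>b. b \<^bold>\<in> B \<and> y = pair a b)" for y a
    by (rule mem_repl) (intro definable_rules)
  moreover have "y \<^bold>\<in> repl A (\<lambda>a. repl B (\<lambda>b. pair a b)) \<longleftrightarrow> (\<exists>a. a \<^bold>\<in> A \<and> y = repl B (\<lambda>b. pair a b))" for y
    by (rule mem_repl) (intro definable_rules)
  ultimately show ?thesis unfolding prod_set_def by auto
qed

definition funs :: "'v \<Rightarrow> 'v \<Rightarrow> 'v" where
  "funs A B = coll (\<lambda>f. is_function f A B)"

lemma mem_funs [simp]: "f \<^bold>\<in> funs A B \<longleftrightarrow> is_function f A B"
  unfolding funs_def
proof (rule mem_coll_subset[where A = "sPow (prod_set A B)"])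
  show "definable (\<lambda>s. is_function (s 0) A B)" by (intro definable_rules)
  show "f \<^bold>\<in> sPow (prod_set A B)" if "is_function f A B" for f
    using that by (auto simp: is_function_def is_pair_iff subset_def mem_prod_set)
qed

section \<open>Natural numbers\<close>

definition zero :: 'v where "zero = coll (\<lambda>_. False)"

definition omega :: 'v where
  "omega = coll (\<lambda>n. \<forall>I. is_inductive I \<longrightarrow> n \<^bold>\<in> I)"

lemma not_mem_zero [simp]: "\<not> x \<^bold>\<in> zero"
proof -
  have "\<not> x \<^bold>\<in> sDiff x x" by simp
  then show ?thesis
    unfolding zero_def using mem_coll_ex(2)[of "sDiff x x" "\<lambda>_. False"] by simp
qed

lemma is_empty_iff: "is_empty e \<longleftrightarrow> e = zero"
  unfolding is_empty_def by (auto intro: ext)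

lemma is_inductive_iff: "is_inductive I \<longleftrightarrow> zero \<^bold>\<in> I \<and> (\<forall>x. x \<^bold>\<in> I \<longrightarrow> sSucc x \<^bold>\<in> I)"
  unfolding is_inductive_def is_empty_iff is_succ_iff by simp

lemma mem_omega: "n \<^bold>\<in> omega \<longleftrightarrow> (\<forall>I. is_inductive I \<longrightarrow> n \<^bold>\<in> I)"
proof -
  obtain I where "is_inductive I" using infinity by blast
  then show ?thesis
    unfolding omega_def by (intro mem_coll_subset[where A = I] definable_rules) auto
qed

lemma zero_omega [simp]: "zero \<^bold>\<in> omega"
  by (simp add: mem_omega is_inductive_iff)

lemma sSucc_omega [simp]: "n \<^bold>\<in> omega \<Longrightarrow> sSucc n \<^bold>\<in> omega"
  by (simp add: mem_omega is_inductive_iff)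

lemma is_omega_iff: "is_omega w \<longleftrightarrow> w = omega"
proof
  have "is_inductive omega" by (simp add: is_inductive_iff)
  moreover have "omega \<^bold>\<subseteq> I" if "is_inductive I" for I
    using that by (simp add: subset_def mem_omega)
  ultimately show "is_omega w" if "w = omega"
    using that by (simp add: is_omega_def)
  show "w = omega" if "is_omega w"
  proof (rule ext)
    show "z \<^bold>\<in> w \<longleftrightarrow> z \<^bold>\<in> omega" for z
      using that \<open>is_inductive omega\<close> unfolding is_omega_def subset_def mem_omega by blast
  qed
qed

lemma omega_induct:
  assumes "n \<^bold>\<in> omega" "definable (\<lambda>s. Q (s 0))" "Q zero"
    "\<And>n. n \<^bold>\<in> omega \<Longrightarrow> Q n \<Longrightarrow> Q (sSucc n)"
  shows "Q n"
proof -
  have m: "x \<^bold>\<in> coll (\<lambda>n. n \<^bold>\<in> omega \<and> Q n) \<longleftrightarrow> x \<^bold>\<in> omega \<and> Q x" for x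
    by (rule mem_sep[OF assms(2)])
  have "is_inductive (coll (\<lambda>n. n \<^bold>\<in> omega \<and> Q n))"
    unfolding is_inductive_iff m using assms(3-4) by simp
  then show ?thesis using assms(1) m unfolding mem_omega by blast
qed

text \<open>The usual double induction; the inner one shows that \<open>m \<in> n\<close> implies \<open>m + 1 \<in> n\<close> or
  \<open>m + 1 = n\<close>.\<close>

lemma omega_linear:
  assumes "m \<^bold>\<in> omega" "n \<^bold>\<in> omega"
  shows "m \<^bold>\<in> n \<or> m = n \<or> n \<^bold>\<in> m"
proof -
  have zero: "zero = n \<or> zero \<^bold>\<in> n" if "n \<^bold>\<in> omega" for n
    by (rule omega_induct[OF that]) (intro definable_rules, auto)
  have succ: "\<forall>m. m \<^bold>\<in> n \<longrightarrow> sSucc m \<^bold>\<in> n \<or> sSucc m = n" if "n \<^bold>\<in> omega" for n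
    by (rule omega_induct[OF that]) (intro definable_rules, auto)
  show ?thesis
  proof (rule omega_induct[OF assms(1)])
    show "definable (\<lambda>s. s 0 \<^bold>\<in> n \<or> s 0 = n \<or> n \<^bold>\<in> s 0)" by (intro definable_rules)
    show "zero \<^bold>\<in> n \<or> zero = n \<or> n \<^bold>\<in> zero" using zero[OF assms(2)] by auto
    show "sSucc k \<^bold>\<in> n \<or> sSucc k = n \<or> n \<^bold>\<in> sSucc k" if "k \<^bold>\<in> n \<or> k = n \<or> n \<^bold>\<in> k" for k
      using that succ[OF assms(2)] by auto
  qed
qed

text \<open>Foundation provides a \<open>\<in>\<close>-minimal element, and linearity of \<open>\<in>\<close> on \<open>\<omega>\<close> makes it unique.\<close>

lemma least_number:
  assumes "B \<^bold>\<subseteq> omega" "n \<^bold>\<in> B" "definable (\<lambda>s. Q (s 0))" "Q n"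
  shows "\<exists>!n. n \<^bold>\<in> B \<and> Q n \<and> (\<forall>m. m \<^bold>\<in> n \<longrightarrow> m \<^bold>\<in> B \<longrightarrow> \<not> Q m)"
proof -
  have m: "x \<^bold>\<in> coll (\<lambda>n. n \<^bold>\<in> B \<and> Q n) \<longleftrightarrow> x \<^bold>\<in> B \<and> Q x" for x
    by (rule mem_sep[OF assms(3)])
  have "\<exists>k. k \<^bold>\<in> coll (\<lambda>n. n \<^bold>\<in> B \<and> Q n) \<and> \<not> (\<exists>z. z \<^bold>\<in> coll (\<lambda>n. n \<^bold>\<in> B \<and> Q n) \<and> z \<^bold>\<in> k)"
    using foundation assms(2,4) m by blast
  then obtain k where "k \<^bold>\<in> B \<and> Q k \<and> (\<forall>m. m \<^bold>\<in> k \<longrightarrow> m \<^bold>\<in> B \<longrightarrow> \<not> Q m)"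
    unfolding m by blast
  then show ?thesis
    using omega_linear assms(1) unfolding subset_def by (intro ex1I[of _ k]) blast+
qed

section \<open>Topological spaces\<close>

lemma subset_iff: "A \<^bold>\<subseteq> B \<longleftrightarrow> (\<forall>z. z \<^bold>\<in> A \<longrightarrow> z \<^bold>\<in> B)"
  by (rule subset_def)

lemma topology_subset: "topological_space X T \<Longrightarrow> U \<^bold>\<in> T \<Longrightarrow> U \<^bold>\<subseteq> X"
  unfolding topological_space_def by blast

lemma topology_whole: "topological_space X T \<Longrightarrow> X \<^bold>\<in> T"
  unfolding topological_space_def by blast

lemma topology_zero: "topological_space X T \<Longrightarrow> zero \<^bold>\<in> T"
  unfolding topological_space_def is_empty_iff by blast

lemma topology_Union: "topological_space X T \<Longrightarrow> S \<^bold>\<subseteq> T \<Longrightarrow> sUnion S \<^bold>\<in> T"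
  unfolding topological_space_def is_Union_iff by blast

lemma topology_inter: "topological_space X T \<Longrightarrow> U \<^bold>\<in> T \<Longrightarrow> V \<^bold>\<in> T \<Longrightarrow> sInter U V \<^bold>\<in> T"
  unfolding topological_space_def is_inter_iff by blast

lemma topological_spaceI:
  assumes "\<And>U. U \<^bold>\<in> T \<Longrightarrow> U \<^bold>\<subseteq> X" "zero \<^bold>\<in> T" "X \<^bold>\<in> T"
    "\<And>S. S \<^bold>\<subseteq> T \<Longrightarrow> sUnion S \<^bold>\<in> T" "\<And>U V. U \<^bold>\<in> T \<Longrightarrow> V \<^bold>\<in> T \<Longrightarrow> sInter U V \<^bold>\<in> T"
  shows "topological_space X T"
  unfolding topological_space_def is_Union_iff is_inter_iff is_empty_iff using assms by blast

text \<open>No neighbourhoods have to be chosen: \<open>U\<close> is the union of \<^emph>\<open>all\<close> open sets inside \<open>U\<close>.\<close>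

lemma topology_local:
  assumes "topological_space X T" "\<And>x. x \<^bold>\<in> U \<Longrightarrow> \<exists>V. V \<^bold>\<in> T \<and> x \<^bold>\<in> V \<and> V \<^bold>\<subseteq> U"
  shows "U \<^bold>\<in> T"
proof -
  define S where "S = coll (\<lambda>V. V \<^bold>\<in> T \<and> V \<^bold>\<subseteq> U)"
  have S: "V \<^bold>\<in> S \<longleftrightarrow> V \<^bold>\<in> T \<and> V \<^bold>\<subseteq> U" for V
    unfolding S_def by (rule mem_sep) (intro definable_rules)
  have "sUnion S \<^bold>\<in> T"
    by (rule topology_Union[OF assms(1)]) (simp add: subset_iff[of S] S)
  moreover have "sUnion S = U"
    by (rule ext) (use assms(2) in \<open>auto simp: S subset_iff\<close>)
  ultimately show ?thesis by simp
qed

lemma closed_in_iff: "closed_in X T C \<longleftrightarrow> C \<^bold>\<subseteq> X \<and> sDiff X C \<^bold>\<in> T"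
  unfolding closed_in_def is_diff_iff by simp

lemma clopen_in_iff:
  "topological_space X T \<Longrightarrow> clopen_in X T C \<longleftrightarrow> C \<^bold>\<in> T \<and> sDiff X C \<^bold>\<in> T"
  unfolding clopen_in_def closed_in_iff using topology_subset by blast

lemma diff_diff: "A \<^bold>\<subseteq> X \<Longrightarrow> sDiff X (sDiff X A) = A"
  by (rule ext) (auto simp: subset_iff)

lemma clopen_whole:
  assumes "topological_space X T" shows "clopen_in X T X"
proof -
  have "sDiff X X = zero" by (rule ext) simp
  then show ?thesis
    using topology_zero[OF assms] topology_whole[OF assms] by (simp add: clopen_in_iff[OF assms])
qed

lemma clopen_diff:
  assumes "topological_space X T" "clopen_in X T A" shows "clopen_in X T (sDiff X A)"
  using assms(2) diff_diff[OF topology_subset[OF assms(1)]]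
  by (auto simp: clopen_in_iff[OF assms(1)])

lemma clopen_inter:
  assumes "topological_space X T" "clopen_in X T A" "clopen_in X T B"
  shows "clopen_in X T (sInter A B)"
proof -
  have "sDiff X (sInter A B) = sUnion (upair (sDiff X A) (sDiff X B))"
    by (rule ext) auto
  moreover have "sUnion (upair (sDiff X A) (sDiff X B)) \<^bold>\<in> T"
    using assms(2-3) by (intro topology_Union[OF assms(1)])
      (auto simp: clopen_in_iff[OF assms(1)] subset_iff[of "upair _ _"])
  ultimately show ?thesis
    using assms topology_inter by (simp add: clopen_in_iff[OF assms(1)])
qed

lemma zero_dimensional_nbhd:
  assumes "zero_dimensional X T" "U \<^bold>\<in> T" "x \<^bold>\<in> U"
  shows "\<exists>A. clopen_in X T A \<and> x \<^bold>\<in> A \<and> A \<^bold>\<subseteq> U"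
proof -
  obtain B where B: "is_CO B X T" "is_base B T"
    using assms(1) unfolding zero_dimensional_def by blast
  obtain S where S: "S \<^bold>\<subseteq> B" "U = sUnion S"
    using B(2) assms(2) unfolding is_base_def is_Union_iff by blast
  then obtain A where "A \<^bold>\<in> S" "x \<^bold>\<in> A" using assms(3) by auto
  with S B(1) show ?thesis unfolding is_CO_def subset_iff by auto
qed

lemma subspace_inter: "is_subspace_topology TC C T \<Longrightarrow> V \<^bold>\<in> T \<Longrightarrow> sInter V C \<^bold>\<in> TC"
  unfolding is_subspace_topology_def is_inter_iff by blast

definition preimage :: "'v \<Rightarrow> 'v \<Rightarrow> 'v \<Rightarrow> 'v" where
  "preimage f A V = coll (\<lambda>x. x \<^bold>\<in> A \<and> val f x \<^bold>\<in> V)"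

lemma mem_preimage [simp]: "x \<^bold>\<in> preimage f A V \<longleftrightarrow> x \<^bold>\<in> A \<and> val f x \<^bold>\<in> V"
  unfolding preimage_def by (rule mem_sep) (intro definable_rules)

lemma definable_term_preimage [definable_rules]:
  assumes "definable_term t" "definable_term u" "definable_term v"
  shows "definable_term (\<lambda>s. preimage (t s) (u s) (v s))"
  unfolding preimage_def by (intro definable_rules assms assms[THEN definable_term_rename])

lemma is_preimage_iff:
  assumes "is_function f A B"
  shows "is_preimage W f A V \<longleftrightarrow> W = preimage f A V"
  unfolding is_preimage_def app_function_iff[OF assms] by (intro eq_iff_mem) auto

lemma continuous_map_iff:
  "continuous_map f X T Y S \<longleftrightarrow> is_function f X Y \<and> (\<forall>V. V \<^bold>\<in> S \<longrightarrow> preimage f X V \<^bold>\<in> T)"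
  unfolding continuous_map_def using is_preimage_iff by auto

section \<open>Powers of a space\<close>

definition cylinder :: "'v \<Rightarrow> 'v \<Rightarrow> 'v \<Rightarrow> 'v" where
  "cylinder P j V = coll (\<lambda>z. z \<^bold>\<in> P \<and> val z j \<^bold>\<in> V)"

lemma mem_cylinder [simp]: "z \<^bold>\<in> cylinder P j V \<longleftrightarrow> z \<^bold>\<in> P \<and> val z j \<^bold>\<in> V"
  unfolding cylinder_def by (rule mem_sep) (intro definable_rules)

lemma definable_term_cylinder [definable_rules]:
  assumes "definable_term t" "definable_term u" "definable_term v"
  shows "definable_term (\<lambda>s. cylinder (t s) (u s) (v s))"
  unfolding cylinder_def by (intro definable_rules assms assms[THEN definable_term_rename])

lemma contains_subbasic_iff:
  assumes "\<And>z. z \<^bold>\<in> P \<Longrightarrow> is_function z J Y"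
  shows "contains_subbasic T P S J \<longleftrightarrow>
    (\<forall>j V. j \<^bold>\<in> J \<and> V \<^bold>\<in> S \<longrightarrow> cylinder P j V \<^bold>\<in> T)"
proof -
  have *: "(\<forall>z. z \<^bold>\<in> W \<longleftrightarrow> z \<^bold>\<in> P \<and> (\<exists>y. y \<^bold>\<in> V \<and> app z j y)) \<longleftrightarrow>
      W = cylinder P j V" if "j \<^bold>\<in> J" for j V W
  proof -
    have "z \<^bold>\<in> cylinder P j V \<longleftrightarrow> z \<^bold>\<in> P \<and> (\<exists>y. y \<^bold>\<in> V \<and> app z j y)" for z
      using app_function_iff[OF assms, of z j] that by (cases "z \<^bold>\<in> P") simp_all
    then show ?thesis by (rule eq_iff_mem)
  qed
  have "contains_subbasic T P S J \<longleftrightarrow>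
    (\<forall>j V W. j \<^bold>\<in> J \<longrightarrow> V \<^bold>\<in> S \<longrightarrow> W = cylinder P j V \<longrightarrow> W \<^bold>\<in> T)"
    unfolding contains_subbasic_def imp_conjL by (intro iff_allI imp_cong refl) (rule *)
  then show ?thesis by auto
qed

text \<open>The product topology is the intersection of all topologies that contain the subbasic sets.\<close>

lemma power_space_exists: "\<exists>TP. is_power_space (funs J Y) TP Y S J"
proof
  let ?P = "funs J Y"
  define Q where "Q T' \<longleftrightarrow> topological_space ?P T' \<and> contains_subbasic T' ?P S J" for T'
  define TP where "TP = coll (\<lambda>W. W \<^bold>\<subseteq> ?P \<and> (\<forall>T'. Q T' \<longrightarrow> W \<^bold>\<in> T'))"
  have TP: "W \<^bold>\<in> TP \<longleftrightarrow> W \<^bold>\<subseteq> ?P \<and> (\<forall>T'. Q T' \<longrightarrow> W \<^bold>\<in> T')" for W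
    unfolding TP_def Q_def
    by (rule mem_coll_subset[where A = "sPow ?P"]) (intro definable_rules, simp)
  have "topological_space ?P TP"
  proof (rule topological_spaceI)
    fix S assume "S \<^bold>\<subseteq> TP"
    then have "sUnion S \<^bold>\<in> T'" if "Q T'" for T'
      using that topology_Union[of ?P T' S] unfolding Q_def subset_iff[of S] TP by blast
    then show "sUnion S \<^bold>\<in> TP"
      using \<open>S \<^bold>\<subseteq> TP\<close> unfolding TP by (auto simp: subset_iff TP)
  qed (auto simp: TP Q_def subset_iff intro: topology_zero topology_whole topology_inter)
  moreover have "contains_subbasic TP ?P S J"
    unfolding contains_subbasic_def
  proof (intro allI impI)
    fix j V W
    assume *: "j \<^bold>\<in> J \<and> V \<^bold>\<in> S \<and> (\<forall>z. z \<^bold>\<in> W \<longleftrightarrow> z \<^bold>\<in> ?P \<and> (\<exists>y. y \<^bold>\<in> V \<and> app z j y))"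
    then have "W \<^bold>\<in> T'" if "Q T'" for T'
      using that unfolding Q_def contains_subbasic_def by blast
    with * show "W \<^bold>\<in> TP" unfolding TP by (simp add: subset_iff)
  qed
  ultimately show "is_power_space ?P TP Y S J"
    unfolding is_power_space_def Q_def[symmetric] by (simp add: subset_iff TP)
qed

lemma power_space_topology: "is_power_space P TP Y S J \<Longrightarrow> topological_space P TP"
  unfolding is_power_space_def by blast

lemma power_space_mem: "is_power_space P TP Y S J \<Longrightarrow> z \<^bold>\<in> P \<longleftrightarrow> is_function z J Y"
  unfolding is_power_space_def by blast

lemma power_space_subbasic:
  assumes "is_power_space P TP Y S J" "j \<^bold>\<in> J" "V \<^bold>\<in> S"
  shows "cylinder P j V \<^bold>\<in> TP"
proof -
  have "contains_subbasic TP P S J" using assms(1) unfolding is_power_space_def by blast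
  then show ?thesis
    using assms(2-3) contains_subbasic_iff[of P J Y TP S] power_space_mem[OF assms(1)] by blast
qed

text \<open>This serves as an induction principle for the open sets of a power: \<open>T'\<close> is taken to be the
  family of all sets with the property to be proved.\<close>

lemma power_space_least:
  assumes "is_power_space P TP Y S J" "topological_space P T'"
    "\<And>j V. j \<^bold>\<in> J \<Longrightarrow> V \<^bold>\<in> S \<Longrightarrow> cylinder P j V \<^bold>\<in> T'"
  shows "TP \<^bold>\<subseteq> T'"
proof -
  have "contains_subbasic T' P S J"
    using assms(3) contains_subbasic_iff[of P J Y T' S] power_space_mem[OF assms(1)] by blast
  then show ?thesis using assms(1,2) unfolding is_power_space_def by blast
qed

section \<open>Clopen ultrafilters\<close>

lemma filter_clopen: "clopen_filter X T F \<Longrightarrow> A \<^bold>\<in> F \<Longrightarrow> clopen_in X T A"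
  unfolding clopen_filter_def by blast

lemma filter_nonempty: "clopen_filter X T F \<Longrightarrow> A \<^bold>\<in> F \<Longrightarrow> \<exists>x. x \<^bold>\<in> A"
  unfolding clopen_filter_def is_empty_def by blast

lemma filter_inter: "clopen_filter X T F \<Longrightarrow> A \<^bold>\<in> F \<Longrightarrow> B \<^bold>\<in> F \<Longrightarrow> sInter A B \<^bold>\<in> F"
  unfolding clopen_filter_def is_inter_iff by blast

lemma filter_superset:
  "clopen_filter X T F \<Longrightarrow> A \<^bold>\<in> F \<Longrightarrow> A \<^bold>\<subseteq> B \<Longrightarrow> clopen_in X T B \<Longrightarrow> B \<^bold>\<in> F"
  unfolding clopen_filter_def by blast

lemma filter_ex: "clopen_filter X T F \<Longrightarrow> \<exists>A. A \<^bold>\<in> F"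
  unfolding clopen_filter_def is_empty_def by blast

text \<open>If neither \<open>A\<close> nor its complement were in \<open>F\<close>, then \<open>A\<close> would meet every member of \<open>F\<close>, and \<open>F\<close>
  together with \<open>A\<close> would generate a strictly larger clopen filter.\<close>

lemma ultrafilter_dichotomy:
  assumes top: "topological_space X T" and F: "clopen_ultrafilter X T F"
    and A: "clopen_in X T A" "\<not> A \<^bold>\<in> F"
  shows "sDiff X A \<^bold>\<in> F"
proof (rule ccontr)
  assume notin: "\<not> sDiff X A \<^bold>\<in> F"
  have filt: "clopen_filter X T F"
    and max: "\<And>G. clopen_filter X T G \<Longrightarrow> F \<^bold>\<subseteq> G \<Longrightarrow> G = F"
    using F unfolding clopen_ultrafilter_def by blast+
  define G where "G = coll (\<lambda>B. clopen_in X T B \<and> (\<exists>E. E \<^bold>\<in> F \<and> sInter E A \<^bold>\<subseteq> B))"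
  have G: "B \<^bold>\<in> G \<longleftrightarrow> clopen_in X T B \<and> (\<exists>E. E \<^bold>\<in> F \<and> sInter E A \<^bold>\<subseteq> B)" for B
    unfolding G_def
    by (rule mem_coll_subset[where A = T]) (intro definable_rules, simp add: clopen_in_def)
  have meets: "\<exists>x. x \<^bold>\<in> sInter E A" if "E \<^bold>\<in> F" for E
  proof (rule ccontr)
    assume "\<nexists>x. x \<^bold>\<in> sInter E A"
    moreover have "E \<^bold>\<subseteq> X"
      using filter_clopen[OF filt that] unfolding clopen_in_def closed_in_iff by blast
    ultimately have "E \<^bold>\<subseteq> sDiff X A" by (auto simp: subset_iff)
    then show False
      using filter_superset[OF filt that] clopen_diff[OF top A(1)] notin by blast
  qed
  have "clopen_filter X T G"
    unfolding clopen_filter_def is_inter_iff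
  proof (intro conjI allI impI)
    obtain E where "E \<^bold>\<in> F" using filter_ex[OF filt] by blast
    then have "X \<^bold>\<in> G"
      unfolding G using clopen_whole[OF top] A(1)
      by (auto simp: subset_iff clopen_in_def closed_in_def)
    then show "\<not> is_empty G" unfolding is_empty_def by blast
    show "\<not> is_empty B" if "B \<^bold>\<in> G" for B
      using that meets unfolding G is_empty_def subset_iff by blast
    show "D \<^bold>\<in> G" if *: "B \<^bold>\<in> G \<and> C \<^bold>\<in> G \<and> D = sInter B C" for B C D
    proof -
      obtain E E' where E: "E \<^bold>\<in> F" "sInter E A \<^bold>\<subseteq> B" "E' \<^bold>\<in> F" "sInter E' A \<^bold>\<subseteq> C"
        using * unfolding G by blast
      then have "sInter (sInter E E') A \<^bold>\<subseteq> D" using * by (simp add: subset_iff)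
      moreover have "clopen_in X T D" using * clopen_inter[OF top] unfolding G by blast
      ultimately show ?thesis unfolding G using filter_inter[OF filt] E by blast
    qed
  qed (auto simp: G subset_iff)
  moreover have "F \<^bold>\<subseteq> G"
    using filter_clopen[OF filt] by (auto simp: subset_iff G)
  ultimately have "G = F" by (rule max)
  moreover obtain E where "E \<^bold>\<in> F" using filter_ex[OF filt] by blast
  then have "A \<^bold>\<in> G" unfolding G using A(1) by (auto simp: subset_iff)
  ultimately show False using A(2) by simp
qed

lemma countable_repl:
  assumes "B \<^bold>\<subseteq> omega" "definable_term (\<lambda>s. K (s 0))"
    "\<And>m n. m \<^bold>\<in> B \<Longrightarrow> n \<^bold>\<in> B \<Longrightarrow> K m = K n \<Longrightarrow> m = n"
  shows "is_countable (repl B K)"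
proof -
  define f where "f = repl B (\<lambda>n. pair (K n) n)"
  have f: "p \<^bold>\<in> f \<longleftrightarrow> (\<exists>n. n \<^bold>\<in> B \<and> p = pair (K n) n)" for p
    unfolding f_def by (rule mem_repl) (intro definable_rules assms(2))
  have "is_bijection f (repl B K) B"
    unfolding is_bijection_def is_function_def app_iff is_pair_iff f mem_repl[OF assms(2)]
    using assms(3) by (auto simp: Ex1_def)
  then show ?thesis
    unfolding is_countable_def is_omega_iff using assms(1) by blast
qed

definition fiber :: "'v \<Rightarrow> ('v \<Rightarrow> 'v) \<Rightarrow> 'v \<Rightarrow> 'v" where
  "fiber X g n = coll (\<lambda>x. x \<^bold>\<in> X \<and> g x = n)"

lemma definable_term_fiber [definable_rules]:
  assumes "definable_term t" "definable_term (\<lambda>s. g (\<lambda>n. s (Suc n)) (s 0))" "definable_term u"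
  shows "definable_term (\<lambda>s. fiber (t s) (g s) (u s))"
  unfolding fiber_def by (intro definable_rules assms assms(1,3)[THEN definable_term_rename])

lemma mem_fiber:
  assumes "definable_term (\<lambda>s. g (s 0))"
  shows "x \<^bold>\<in> fiber X g n \<longleftrightarrow> x \<^bold>\<in> X \<and> g x = n"
  unfolding fiber_def by (rule mem_sep) (intro definable_rules assms)

text \<open>
  If no fiber is in \<open>F\<close>, then all complements of fibers are, and they have no common point. Only the
  values \<open>n\<close> that \<open>g\<close> takes are used for this countable family, so that \<open>n\<close> can be recovered from
  its fiber; otherwise several \<open>n\<close> would share the empty fiber. Two fibers in \<open>F\<close> would be disjoint.
\<close>

lemma ultrafilter_fiber:
  assumes top: "topological_space X T" and F: "clopen_ultrafilter X T F"
    and cip: "countable_intersection_property F"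
    and g: "definable_term (\<lambda>s. g (s 0))" "\<And>x. x \<^bold>\<in> X \<Longrightarrow> g x \<^bold>\<in> omega"
    and clopen: "\<And>n. n \<^bold>\<in> omega \<Longrightarrow> clopen_in X T (fiber X g n)"
  shows "\<exists>!n. n \<^bold>\<in> omega \<and> fiber X g n \<^bold>\<in> F"
proof -
  have filt: "clopen_filter X T F" using F unfolding clopen_ultrafilter_def by blast
  have "\<exists>n. n \<^bold>\<in> omega \<and> fiber X g n \<^bold>\<in> F"
  proof (rule ccontr)
    assume none: "\<nexists>n. n \<^bold>\<in> omega \<and> fiber X g n \<^bold>\<in> F"
    define B where "B = repl X g"
    have B: "n \<^bold>\<in> B \<longleftrightarrow> (\<exists>x. x \<^bold>\<in> X \<and> n = g x)" for n
      unfolding B_def by (rule mem_repl[OF g(1)])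
    define H where "H = repl B (\<lambda>n. sDiff X (fiber X g n))"
    have K: "definable_term (\<lambda>s. sDiff X (fiber X g (s 0)))"
      using definable_term_rename[OF g(1), of "\<lambda>_. 0"] by (intro definable_rules)
    have H: "A \<^bold>\<in> H \<longleftrightarrow> (\<exists>n. n \<^bold>\<in> B \<and> A = sDiff X (fiber X g n))" for A
      unfolding H_def by (rule mem_repl[OF K])
    have "B \<^bold>\<subseteq> omega" using g(2) by (auto simp: subset_iff B)
    have "is_countable H"
      unfolding H_def
    proof (rule countable_repl[OF \<open>B \<^bold>\<subseteq> omega\<close> K])
      fix m n
      assume "m \<^bold>\<in> B" "sDiff X (fiber X g m) = sDiff X (fiber X g n)"
      then show "m = n" unfolding B by (metis mem_sDiff mem_fiber[OF g(1)])
    qed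
    moreover have "H \<^bold>\<subseteq> F"
      using none ultrafilter_dichotomy[OF top F clopen] \<open>B \<^bold>\<subseteq> omega\<close>
      by (auto simp: subset_iff H)
    moreover have "\<not> is_empty H"
    proof -
      obtain x where "x \<^bold>\<in> X"
        using filter_ex[OF filt] filter_nonempty[OF filt] filter_clopen[OF filt]
        unfolding clopen_in_def closed_in_iff subset_iff by blast
      then show ?thesis unfolding is_empty_def H B by blast
    qed
    ultimately obtain x where x: "\<And>A. A \<^bold>\<in> H \<Longrightarrow> x \<^bold>\<in> A"
      using cip unfolding countable_intersection_property_def fixed_family_def by blast
    obtain A where "A \<^bold>\<in> H" using \<open>\<not> is_empty H\<close> unfolding is_empty_def by blast
    then have "x \<^bold>\<in> X" using x[of A] by (auto simp: H)
    then have "sDiff X (fiber X g (g x)) \<^bold>\<in> H" unfolding H B by blast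
    from x[OF this] show False using \<open>x \<^bold>\<in> X\<close> by (simp add: mem_fiber[OF g(1)])
  qed
  then obtain n where n: "n \<^bold>\<in> omega" "fiber X g n \<^bold>\<in> F" by blast
  moreover have "m = n" if "fiber X g m \<^bold>\<in> F" for m
    using filter_nonempty[OF filt filter_inter[OF filt that n(2)]] by (auto simp: mem_fiber[OF g(1)])
  ultimately show ?thesis by blast
qed

section \<open>Closed subspaces of powers of omega\<close>

text \<open>The fibers in \<open>F\<close> of the coordinate functions determine a point \<open>p\<close> of the power, and \<open>F\<close>
  converges to it along the homeomorphism.\<close>

lemma N_compact_imp_fixed:
  assumes top: "topological_space X T" and "N_compact X T"
    and F: "clopen_ultrafilter X T F" and cip: "countable_intersection_property F"
  shows "fixed_family F"
proof -
  have filt: "clopen_filter X T F" using F unfolding clopen_ultrafilter_def by blast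
  obtain J P TP C TC h h' where pow: "is_power_space P TP omega (sPow omega) J"
    and C: "closed_in P TP C" and TC: "is_subspace_topology TC C TP"
    and bij: "is_bijection h X C" and inv: "\<And>y x. app h' y x \<longleftrightarrow> app h x y"
    and cont: "continuous_map h X T C TC" "continuous_map h' C TC X T"
    using assms(2) unfolding N_compact_def homeomorphic_def is_omega_iff is_Pow_iff by blast
  have h: "is_function h X C" and h': "is_function h' C X"
    using cont unfolding continuous_map_iff by blast+
  have "C \<^bold>\<subseteq> P" using C unfolding closed_in_iff by blast
  then have hP: "val h x \<^bold>\<in> P" if "x \<^bold>\<in> X" for x
    using val_in_codomain[OF h that] by (simp add: subset_iff)
  have coord: "val (val h x) j \<^bold>\<in> omega" if "x \<^bold>\<in> X" "j \<^bold>\<in> J" for x j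
    using val_in_codomain[OF _ that(2)] hP[OF that(1)] power_space_mem[OF pow] by blast
  have preim_open: "preimage h X W \<^bold>\<in> T" if "W \<^bold>\<in> TP" for W
  proof -
    have "preimage h X (sInter W C) \<^bold>\<in> T"
      using cont(1) subspace_inter[OF TC that] unfolding continuous_map_iff by blast
    moreover have "preimage h X (sInter W C) = preimage h X W"
      by (rule ext) (use val_in_codomain[OF h] in \<open>auto\<close>)
    ultimately show ?thesis by simp
  qed
  let ?fib = "\<lambda>j. fiber X (\<lambda>x. val (val h x) j)"
  have fib: "x \<^bold>\<in> ?fib j n \<longleftrightarrow> x \<^bold>\<in> X \<and> val (val h x) j = n" for x j n
    by (rule mem_fiber) (intro definable_rules)
  have fib_clopen: "clopen_in X T (?fib j n)" if "j \<^bold>\<in> J" "n \<^bold>\<in> omega" for j n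
  proof -
    have "?fib j n = preimage h X (cylinder P j (Sing n))"
      by (rule ext) (use hP in \<open>auto simp: fib\<close>)
    moreover have "sDiff X (?fib j n) = preimage h X (cylinder P j (sDiff omega (Sing n)))"
      by (rule ext) (use hP coord that in \<open>auto simp: fib\<close>)
    moreover have "cylinder P j V \<^bold>\<in> TP" if "V \<^bold>\<subseteq> omega" for V
      using power_space_subbasic[OF pow \<open>j \<^bold>\<in> J\<close>] that by simp
    ultimately show ?thesis
      using that by (simp add: clopen_in_iff[OF top] preim_open subset_iff)
  qed
  define p where "p = lam J (\<lambda>j. unique (\<lambda>n. n \<^bold>\<in> omega \<and> ?fib j n \<^bold>\<in> F))"
  have p_def_term: "definable_term (\<lambda>s. unique (\<lambda>n. n \<^bold>\<in> omega \<and> ?fib (s 0) n \<^bold>\<in> F))"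
    by (intro definable_rules)
  have p_val: "val p j \<^bold>\<in> omega \<and> ?fib j (val p j) \<^bold>\<in> F" if "j \<^bold>\<in> J" for j
  proof -
    have "\<exists>!n. n \<^bold>\<in> omega \<and> ?fib j n \<^bold>\<in> F"
    proof (rule ultrafilter_fiber[OF top F cip])
      show "definable_term (\<lambda>s. val (val h (s 0)) j)" by (intro definable_rules)
    qed (use that coord fib_clopen in auto)
    moreover have "val p j = unique (\<lambda>n. n \<^bold>\<in> omega \<and> ?fib j n \<^bold>\<in> F)"
      unfolding p_def by (rule val_lam[OF p_def_term that])
    ultimately show ?thesis using unique_satisfies[of "\<lambda>n. n \<^bold>\<in> omega \<and> ?fib j n \<^bold>\<in> F"] by simp
  qed
  have "p \<^bold>\<in> P"
    unfolding power_space_mem[OF pow]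
    using p_val lam_function[OF p_def_term, of J omega] val_lam[OF p_def_term, of _ J]
    unfolding p_def by simp
  \<comment> \<open>The topology of sets that contain the image of a member of \<open>F\<close> as soon as they contain \<open>p\<close>.
    By minimality it includes the product topology.\<close>
  define T' where "T' = coll (\<lambda>W. W \<^bold>\<subseteq> P \<and> (p \<^bold>\<in> W \<longrightarrow> (\<exists>A. A \<^bold>\<in> F \<and> (\<forall>x. x \<^bold>\<in> A \<longrightarrow> val h x \<^bold>\<in> W))))"
  have T': "W \<^bold>\<in> T' \<longleftrightarrow> W \<^bold>\<subseteq> P \<and> (p \<^bold>\<in> W \<longrightarrow> (\<exists>A. A \<^bold>\<in> F \<and> (\<forall>x. x \<^bold>\<in> A \<longrightarrow> val h x \<^bold>\<in> W)))" for W
    unfolding T'_def by (rule mem_coll_subset[where A = "sPow P"]) (intro definable_rules, simp)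
  have F_subset: "A \<^bold>\<subseteq> X" if "A \<^bold>\<in> F" for A
    using filter_clopen[OF filt that] unfolding clopen_in_def closed_in_iff by blast
  have "topological_space P T'"
  proof (rule topological_spaceI)
    obtain A where "A \<^bold>\<in> F" using filter_ex[OF filt] by blast
    then show "P \<^bold>\<in> T'" unfolding T' using F_subset[of A] hP by (auto simp: subset_iff)
    show "sUnion S \<^bold>\<in> T'" if "S \<^bold>\<subseteq> T'" for S
    proof -
      have S: "W \<^bold>\<in> T'" if "W \<^bold>\<in> S" for W
        using \<open>S \<^bold>\<subseteq> T'\<close> that unfolding subset_iff by blast
      have "\<exists>A. A \<^bold>\<in> F \<and> (\<forall>x. x \<^bold>\<in> A \<longrightarrow> val h x \<^bold>\<in> sUnion S)" if W: "W \<^bold>\<in> S" "p \<^bold>\<in> W" for W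
      proof -
        obtain A where "A \<^bold>\<in> F" "\<forall>x. x \<^bold>\<in> A \<longrightarrow> val h x \<^bold>\<in> W"
          using S[OF W(1)] W(2) unfolding T' by blast
        then show ?thesis using W(1) by (intro exI[of _ A]) auto
      qed
      moreover have "sUnion S \<^bold>\<subseteq> P"
        using S unfolding T' by (auto simp: subset_iff)
      ultimately show ?thesis unfolding T' by auto
    qed
    show "sInter U V \<^bold>\<in> T'" if "U \<^bold>\<in> T'" "V \<^bold>\<in> T'" for U V
    proof -
      have "\<exists>A. A \<^bold>\<in> F \<and> (\<forall>x. x \<^bold>\<in> A \<longrightarrow> val h x \<^bold>\<in> sInter U V)" if p: "p \<^bold>\<in> sInter U V"
      proof -
        obtain A B where "A \<^bold>\<in> F" "\<forall>x. x \<^bold>\<in> A \<longrightarrow> val h x \<^bold>\<in> U" "B \<^bold>\<in> F" "\<forall>x. x \<^bold>\<in> B \<longrightarrow> val h x \<^bold>\<in> V"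
          using \<open>U \<^bold>\<in> T'\<close> \<open>V \<^bold>\<in> T'\<close> p unfolding T' by auto
        then show ?thesis using filter_inter[OF filt, of A B] by (intro exI[of _ "sInter A B"]) simp
      qed
      then show ?thesis using that unfolding T' by (simp add: subset_iff)
    qed
  qed (auto simp: T' subset_iff)
  then have "TP \<^bold>\<subseteq> T'"
  proof (rule power_space_least[OF pow])
    show "cylinder P j V \<^bold>\<in> T'" if "j \<^bold>\<in> J" for j V
      unfolding T' using p_val[OF that] hP
      by (auto simp: subset_iff fib intro!: exI[of _ "?fib j (val p j)"])
  qed
  then have nbhd: "\<exists>A. A \<^bold>\<in> F \<and> (\<forall>x. x \<^bold>\<in> A \<longrightarrow> val h x \<^bold>\<in> W)" if "W \<^bold>\<in> TP" "p \<^bold>\<in> W" for W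
    using that unfolding subset_iff[of TP] T' by blast
  have "p \<^bold>\<in> C"
  proof (rule ccontr)
    assume "\<not> p \<^bold>\<in> C"
    then obtain A where "A \<^bold>\<in> F" "\<And>x. x \<^bold>\<in> A \<Longrightarrow> val h x \<^bold>\<in> sDiff P C"
      using nbhd[of "sDiff P C"] \<open>p \<^bold>\<in> P\<close> C unfolding closed_in_iff by auto
    moreover obtain x where "x \<^bold>\<in> A" using filter_nonempty[OF filt \<open>A \<^bold>\<in> F\<close>] by blast
    ultimately show False
      using val_in_codomain[OF h, of x] F_subset[of A] by (auto simp: subset_iff)
  qed
  have inj: "x = val h' (val h x)" if "x \<^bold>\<in> X" for x
    using inv app_function_iff[OF h] app_function_iff[OF h'] that by blast
  have "x \<^bold>\<in> A" if "A \<^bold>\<in> F" and x: "x = val h' p" for A x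
  proof (rule ccontr)
    assume "\<not> x \<^bold>\<in> A"
    have "sDiff X A \<^bold>\<in> T"
      using filter_clopen[OF filt \<open>A \<^bold>\<in> F\<close>] by (simp add: clopen_in_iff[OF top])
    then have "preimage h' C (sDiff X A) \<^bold>\<in> TC"
      using cont(2) unfolding continuous_map_iff by blast
    then obtain V where V: "V \<^bold>\<in> TP" "preimage h' C (sDiff X A) = sInter V C"
      using TC unfolding is_subspace_topology_def is_inter_iff by blast
    have V': "y \<^bold>\<in> V \<and> y \<^bold>\<in> C \<longleftrightarrow> y \<^bold>\<in> C \<and> val h' y \<^bold>\<in> sDiff X A" for y
      using arg_cong[OF V(2), of "\<lambda>S. y \<^bold>\<in> S"] by auto
    have "p \<^bold>\<in> V"
      using V'[of p] \<open>p \<^bold>\<in> C\<close> val_in_codomain[OF h' \<open>p \<^bold>\<in> C\<close>] \<open>\<not> x \<^bold>\<in> A\<close> x by simp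
    then obtain B where B: "B \<^bold>\<in> F" "\<And>x. x \<^bold>\<in> B \<Longrightarrow> val h x \<^bold>\<in> V"
      using nbhd[OF V(1)] by blast
    then obtain y where y: "y \<^bold>\<in> A" "y \<^bold>\<in> B"
      using filter_nonempty[OF filt filter_inter[OF filt \<open>A \<^bold>\<in> F\<close> \<open>B \<^bold>\<in> F\<close>]] by auto
    then have "y \<^bold>\<in> X" using F_subset[OF \<open>A \<^bold>\<in> F\<close>] by (simp add: subset_iff)
    then have "val h' (val h y) \<^bold>\<in> sDiff X A"
      using V'[of "val h y"] B(2)[OF y(2)] val_in_codomain[OF h] by blast
    then show False using inj[OF \<open>y \<^bold>\<in> X\<close>] y(1) by simp
  qed
  then show ?thesis unfolding fixed_family_def by blast
qed

section \<open>Continuous functions into omega\<close>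

definition one :: 'v where "one = sSucc zero"

lemma one_omega [simp]: "one \<^bold>\<in> omega"
  by (simp add: one_def)

lemma zero_neq_one [simp]: "zero \<noteq> one" "one \<noteq> zero"
  using mem_sSucc[of zero zero] not_mem_zero[of zero] unfolding one_def by metis+

text \<open>The continuous functions into discrete \<open>\<omega>\<close>: open fibers suffice, since every preimage is a
  union of fibers.\<close>

definition cfuns :: "'v \<Rightarrow> 'v \<Rightarrow> 'v" where
  "cfuns X T = coll (\<lambda>f. is_function f X omega \<and> (\<forall>n. n \<^bold>\<in> omega \<longrightarrow> fiber X (val f) n \<^bold>\<in> T))"

lemma mem_cfuns: "f \<^bold>\<in> cfuns X T \<longleftrightarrow>
    is_function f X omega \<and> (\<forall>n. n \<^bold>\<in> omega \<longrightarrow> fiber X (val f) n \<^bold>\<in> T)"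
  unfolding cfuns_def
  by (rule mem_coll_subset[where A = "funs X omega"]) (intro definable_rules, simp)

lemma mem_fiber_val [simp]: "x \<^bold>\<in> fiber X (val f) n \<longleftrightarrow> x \<^bold>\<in> X \<and> val f x = n"
  by (rule mem_fiber) (intro definable_rules)

lemma cfuns_val: "f \<^bold>\<in> cfuns X T \<Longrightarrow> x \<^bold>\<in> X \<Longrightarrow> val f x \<^bold>\<in> omega"
  using val_in_codomain unfolding mem_cfuns by blast

lemma cfuns_preimage_open:
  assumes top: "topological_space X T" and f: "f \<^bold>\<in> cfuns X T"
  shows "preimage f X V \<^bold>\<in> T"
proof (rule topology_local[OF top])
  fix x assume "x \<^bold>\<in> preimage f X V"
  then show "\<exists>U. U \<^bold>\<in> T \<and> x \<^bold>\<in> U \<and> U \<^bold>\<subseteq> preimage f X V"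
    using f cfuns_val[OF f, of x] unfolding mem_cfuns
    by (intro exI[of _ "fiber X (val f) (val f x)"]) (auto simp: subset_iff)
qed

lemma cfuns_fiber_clopen:
  assumes top: "topological_space X T" and f: "f \<^bold>\<in> cfuns X T"
  shows "clopen_in X T (fiber X (val f) n)"
proof -
  have "fiber X (val f) n = preimage f X (Sing n)"
    by (rule ext) simp
  moreover have "sDiff X (fiber X (val f) n) = preimage f X (sDiff omega (Sing n))"
    by (rule ext) (use cfuns_val[OF f] in auto)
  ultimately show ?thesis
    using cfuns_preimage_open[OF assms] by (simp add: clopen_in_iff[OF top])
qed

definition indicator :: "'v \<Rightarrow> 'v \<Rightarrow> 'v" where
  "indicator X A = lam X (\<lambda>x. if x \<^bold>\<in> A then one else zero)"

lemma definable_term_indicator [definable_rules]: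
  assumes "definable_term t" "definable_term u"
  shows "definable_term (\<lambda>s. indicator (t s) (u s))"
  unfolding indicator_def by (intro definable_rules assms assms[THEN definable_term_rename])

lemma indicator_function: "is_function (indicator X A) X omega"
  unfolding indicator_def by (rule lam_function) (intro definable_rules, simp)

lemma val_indicator: "x \<^bold>\<in> X \<Longrightarrow> val (indicator X A) x = (if x \<^bold>\<in> A then one else zero)"
  unfolding indicator_def by (rule val_lam) (intro definable_rules)

lemma val_indicator_eq_one [simp]: "x \<^bold>\<in> X \<Longrightarrow> val (indicator X A) x = one \<longleftrightarrow> x \<^bold>\<in> A"
  by (simp add: val_indicator)

lemma indicator_cfuns:
  assumes top: "topological_space X T" and A: "clopen_in X T A"
  shows "indicator X A \<^bold>\<in> cfuns X T"
proof -
  have "fiber X (val (indicator X A)) n \<^bold>\<in> T" for n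
  proof (rule topology_local[OF top])
    fix x assume x: "x \<^bold>\<in> fiber X (val (indicator X A)) n"
    have "A \<^bold>\<in> T" "sDiff X A \<^bold>\<in> T" "A \<^bold>\<subseteq> X"
      using A topology_subset[OF top] by (auto simp: clopen_in_iff[OF top])
    with x show "\<exists>V. V \<^bold>\<in> T \<and> x \<^bold>\<in> V \<and> V \<^bold>\<subseteq> fiber X (val (indicator X A)) n"
      by (intro exI[of _ "if x \<^bold>\<in> A then A else sDiff X A"]) (auto simp: subset_iff val_indicator)
  qed
  then show ?thesis by (simp add: mem_cfuns indicator_function)
qed

lemma countable_enumeration:
  assumes "is_countable H"
  obtains B K where "B \<^bold>\<subseteq> omega" "definable_term (\<lambda>s. K (s 0))"
    "\<And>n. n \<^bold>\<in> B \<Longrightarrow> K n \<^bold>\<in> H" "\<And>A. A \<^bold>\<in> H \<Longrightarrow> \<exists>n. n \<^bold>\<in> B \<and> A = K n"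
proof -
  obtain B b where B: "B \<^bold>\<subseteq> omega" and b: "is_bijection b H B"
    using assms unfolding is_countable_def is_omega_iff by blast
  then have fn: "is_function b H B" and ex1: "\<And>n. n \<^bold>\<in> B \<Longrightarrow> \<exists>!A. app b A n"
    unfolding is_bijection_def by blast+
  define K where "K n = unique (\<lambda>A. app b A n)" for n
  have K: "app b (K n) n" if "n \<^bold>\<in> B" for n
    unfolding K_def by (rule unique_satisfies[OF ex1[OF that]])
  show thesis
  proof (rule that[OF B])
    show "definable_term (\<lambda>s. K (s 0))" unfolding K_def by (intro definable_rules)
    show "K n \<^bold>\<in> H" if "n \<^bold>\<in> B" for n
      using K[OF that] app_function_iff[OF fn] by blast
    show "\<exists>n. n \<^bold>\<in> B \<and> A = K n" if "A \<^bold>\<in> H" for A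
    proof (intro exI conjI)
      show "val b A \<^bold>\<in> B" by (rule val_in_codomain[OF fn that])
      have "app b A (val b A)" using app_function_iff[OF fn] that by blast
      then show "A = K (val b A)" using ex1 K \<open>val b A \<^bold>\<in> B\<close> by blast
    qed
  qed
qed

text \<open>
  Enumerate \<open>H\<close> as \<open>(K n)\<close> with \<open>n \<in> B \<subseteq> \<omega>\<close> and let \<open>g x\<close> be the least \<open>n \<in> B\<close> with \<open>x \<notin> K n\<close>. The value
  \<open>g x\<close> alone then reveals a member of \<open>H\<close> that \<open>x\<close> misses. The fiber of \<open>g\<close> at \<open>n\<close> is the part
  outside \<open>K n\<close> of the intersection \<open>M n\<close> of all earlier \<open>K m\<close>, which is open by induction on \<open>n\<close>.
\<close>

lemma separating_function:
  assumes top: "topological_space X T" and H: "is_countable H" "\<And>A. A \<^bold>\<in> H \<Longrightarrow> clopen_in X T A"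
    and free: "\<And>x. x \<^bold>\<in> X \<Longrightarrow> \<exists>A. A \<^bold>\<in> H \<and> \<not> x \<^bold>\<in> A"
  shows "\<exists>g. g \<^bold>\<in> cfuns X T \<and>
    (\<forall>x. x \<^bold>\<in> X \<longrightarrow> (\<exists>A. A \<^bold>\<in> H \<and> (\<forall>y. y \<^bold>\<in> X \<longrightarrow> val g y = val g x \<longrightarrow> \<not> y \<^bold>\<in> A)))"
proof -
  obtain B K where B: "B \<^bold>\<subseteq> omega" and K_term: "definable_term (\<lambda>s. K (s 0))"
    and K: "\<And>n. n \<^bold>\<in> B \<Longrightarrow> K n \<^bold>\<in> H" "\<And>A. A \<^bold>\<in> H \<Longrightarrow> \<exists>n. n \<^bold>\<in> B \<and> A = K n"
    by (rule countable_enumeration[OF H(1)]) blast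
  have K_terms: "definable_term (\<lambda>s. K (s i))" for i
    using definable_term_rename[OF K_term, of "\<lambda>_. i"] by simp
  \<comment> \<open>The double negation is the form in which \<open>least_number\<close>, applied to \<open>x \<notin> K n\<close>, states minimality.\<close>
  define L where "L x n \<longleftrightarrow> n \<^bold>\<in> B \<and> \<not> x \<^bold>\<in> K n \<and> (\<forall>m. m \<^bold>\<in> n \<longrightarrow> m \<^bold>\<in> B \<longrightarrow> \<not> \<not> x \<^bold>\<in> K m)" for x n
  have L1: "\<exists>!n. L x n" if x: "x \<^bold>\<in> X" for x
  proof -
    obtain n where "n \<^bold>\<in> B" "\<not> x \<^bold>\<in> K n" using free[OF x] K(2) by blast
    then show ?thesis
      unfolding L_def by (intro least_number[OF B, of n] definable_rules K_terms)
  qed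
  define G where "G x = unique (L x)" for x
  have G_term: "definable_term (\<lambda>s. G (s 0))"
    unfolding G_def L_def by (intro definable_rules K_terms)
  have G: "L x (G x)" if "x \<^bold>\<in> X" for x
    unfolding G_def by (rule unique_satisfies[OF L1[OF that]])
  have G_iff: "G x = n \<longleftrightarrow> L x n" if "x \<^bold>\<in> X" for x n
    using G[OF that] L1[OF that] by blast
  have clopen: "clopen_in X T (K n)" if "n \<^bold>\<in> B" for n
    using that H(2) K(1) by blast
  have Kopen: "K n \<^bold>\<in> T" "sDiff X (K n) \<^bold>\<in> T" if "n \<^bold>\<in> B" for n
    using clopen[OF that] by (auto simp: clopen_in_iff[OF top])
  define M where "M n = coll (\<lambda>x. x \<^bold>\<in> X \<and> (\<forall>m. m \<^bold>\<in> n \<longrightarrow> m \<^bold>\<in> B \<longrightarrow> x \<^bold>\<in> K m))" for n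
  have M: "x \<^bold>\<in> M n \<longleftrightarrow> x \<^bold>\<in> X \<and> (\<forall>m. m \<^bold>\<in> n \<longrightarrow> m \<^bold>\<in> B \<longrightarrow> x \<^bold>\<in> K m)" for x n
    unfolding M_def by (rule mem_sep) (intro definable_rules K_terms)
  have M_open: "M n \<^bold>\<in> T" if "n \<^bold>\<in> omega" for n
  proof (rule omega_induct[OF that])
    show "definable (\<lambda>s. M (s 0) \<^bold>\<in> T)"
      unfolding M_def by (intro definable_rules K_terms)
    have "M zero = X" by (rule ext) (simp add: M)
    then show "M zero \<^bold>\<in> T" using topology_whole[OF top] by simp
    show "M (sSucc n) \<^bold>\<in> T" if "M n \<^bold>\<in> T" for n
    proof (cases "n \<^bold>\<in> B")
      case True
      have "M (sSucc n) = sInter (M n) (K n)" by (rule ext) (use True in \<open>auto simp: M\<close>)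
      then show ?thesis using topology_inter[OF top that Kopen(1)[OF True]] by simp
    next
      case False
      have "M (sSucc n) = M n" by (rule ext) (use False in \<open>auto simp: M\<close>)
      then show ?thesis using that by simp
    qed
  qed
  define g where "g = lam X G"
  have g: "val g x = G x" if "x \<^bold>\<in> X" for x
    unfolding g_def by (rule val_lam[OF G_term that])
  have fib: "x \<^bold>\<in> fiber X (val g) n \<longleftrightarrow> x \<^bold>\<in> X \<and> L x n" for x n
    by (cases "x \<^bold>\<in> X") (simp_all add: g G_iff)
  have "is_function g X omega"
    unfolding g_def using G B by (intro lam_function G_term) (auto simp: L_def subset_iff)
  moreover have "fiber X (val g) n \<^bold>\<in> T" if "n \<^bold>\<in> omega" for n
  proof (cases "n \<^bold>\<in> B")
    case True
    have "fiber X (val g) n = sInter (M n) (sDiff X (K n))"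
      by (rule ext) (use True in \<open>auto simp: fib L_def M simp del: mem_fiber_val\<close>)
    then show ?thesis using topology_inter[OF top M_open[OF that] Kopen(2)[OF True]] by simp
  next
    case False
    have "fiber X (val g) n = zero"
      by (rule ext) (use False in \<open>auto simp: fib L_def simp del: mem_fiber_val\<close>)
    then show ?thesis using topology_zero[OF top] by simp
  qed
  ultimately have "g \<^bold>\<in> cfuns X T" by (simp add: mem_cfuns)
  moreover have "\<exists>A. A \<^bold>\<in> H \<and> (\<forall>y. y \<^bold>\<in> X \<longrightarrow> val g y = val g x \<longrightarrow> \<not> y \<^bold>\<in> A)" if "x \<^bold>\<in> X" for x
  proof (intro exI conjI allI impI)
    show "K (G x) \<^bold>\<in> H" using G[OF that] K(1) unfolding L_def by blast
    show "\<not> y \<^bold>\<in> K (G x)" if "y \<^bold>\<in> X" "val g y = val g x" for y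
    proof -
      have "L y (G x)" using that G[of y] g[of y] g[OF \<open>x \<^bold>\<in> X\<close>] by simp
      then show ?thesis unfolding L_def by blast
    qed
  qed
  ultimately show ?thesis by blast
qed

section \<open>The evaluation embedding\<close>

definition eval_map :: "'v \<Rightarrow> 'v \<Rightarrow> 'v" where
  "eval_map J x = lam J (\<lambda>f. val f x)"

lemma definable_term_eval_map [definable_rules]:
  assumes "definable_term t" "definable_term u"
  shows "definable_term (\<lambda>s. eval_map (t s) (u s))"
  unfolding eval_map_def by (intro definable_rules assms assms[THEN definable_term_rename])

lemma val_eval_map [simp]: "f \<^bold>\<in> J \<Longrightarrow> val (eval_map J x) f = val f x"
  unfolding eval_map_def by (rule val_lam) (intro definable_rules)

lemma eval_map_function:
  assumes "x \<^bold>\<in> X" shows "is_function (eval_map (cfuns X T) x) (cfuns X T) omega"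
  unfolding eval_map_def
  by (rule lam_function) (intro definable_rules, use cfuns_val assms in blast)

text \<open>
  The assumption \<open>dense\<close> says that \<open>p\<close> is in the closure of the image of \<open>X\<close>: any three coordinates
  of \<open>p\<close> are realised by a point. Three are what closure under intersection requires, namely the
  indicators of \<open>A\<close>, \<open>B\<close> and \<open>A \<inter> B\<close>. For the countable intersection property two coordinates decide:
  a separating function \<open>g\<close> for a free countable \<open>H\<close>, and the indicator of the member of \<open>H\<close> that
  the value of \<open>p\<close> at \<open>g\<close> excludes.
\<close>

lemma closure_point_ultrafilter:
  assumes top: "topological_space X T"
    and dense: "\<And>f g k. f \<^bold>\<in> cfuns X T \<Longrightarrow> g \<^bold>\<in> cfuns X T \<Longrightarrow> k \<^bold>\<in> cfuns X T \<Longrightarrow>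
      \<exists>x. x \<^bold>\<in> X \<and> val f x = val p f \<and> val g x = val p g \<and> val k x = val p k"
    and F_def: "F = coll (\<lambda>A. clopen_in X T A \<and> val p (indicator X A) = one)"
  shows "A \<^bold>\<in> F \<longleftrightarrow> clopen_in X T A \<and> val p (indicator X A) = one"
    and "clopen_ultrafilter X T F" and "countable_intersection_property F"
proof -
  show F: "A \<^bold>\<in> F \<longleftrightarrow> clopen_in X T A \<and> val p (indicator X A) = one" for A
    unfolding F_def
    by (rule mem_coll_subset[where A = T]) (intro definable_rules, simp add: clopen_in_def)
  have agree: "\<exists>x. x \<^bold>\<in> X \<and> (A \<^bold>\<in> F \<longleftrightarrow> x \<^bold>\<in> A) \<and> (B \<^bold>\<in> F \<longleftrightarrow> x \<^bold>\<in> B) \<and> (C \<^bold>\<in> F \<longleftrightarrow> x \<^bold>\<in> C)"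
    if "clopen_in X T A" "clopen_in X T B" "clopen_in X T C" for A B C
  proof -
    obtain x where "x \<^bold>\<in> X" "val (indicator X A) x = val p (indicator X A)"
      "val (indicator X B) x = val p (indicator X B)" "val (indicator X C) x = val p (indicator X C)"
      using dense[OF indicator_cfuns[OF top \<open>clopen_in X T A\<close>]
          indicator_cfuns[OF top \<open>clopen_in X T B\<close>] indicator_cfuns[OF top \<open>clopen_in X T C\<close>]] by blast
    moreover from this have "val p (indicator X A) = one \<longleftrightarrow> x \<^bold>\<in> A"
      "val p (indicator X B) = one \<longleftrightarrow> x \<^bold>\<in> B" "val p (indicator X C) = one \<longleftrightarrow> x \<^bold>\<in> C"
      by (metis val_indicator_eq_one)+
    ultimately show ?thesis using F that by blast
  qed
  have F_clopen: "clopen_in X T A" if "A \<^bold>\<in> F" for A using that F by blast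
  have filt: "clopen_filter X T F"
    unfolding clopen_filter_def is_inter_iff is_empty_def
  proof (intro conjI allI impI)
    have "X \<^bold>\<in> F" using agree[of X X X] clopen_whole[OF top] by blast
    then show "\<not> (\<forall>z. \<not> z \<^bold>\<in> F)" by blast
    show "\<not> (\<forall>z. \<not> z \<^bold>\<in> A)" if "A \<^bold>\<in> F" for A
      using that agree[of A A A] F_clopen by blast
    show "C \<^bold>\<in> F" if *: "A \<^bold>\<in> F \<and> B \<^bold>\<in> F \<and> C = sInter A B" for A B C
    proof -
      have "clopen_in X T A" "clopen_in X T B" using * F_clopen by auto
      moreover from this have "clopen_in X T C" using * clopen_inter[OF top] by blast
      ultimately show ?thesis using agree[of A B C] * by auto
    qed
    show "B \<^bold>\<in> F" if *: "A \<^bold>\<in> F \<and> A \<^bold>\<subseteq> B \<and> clopen_in X T B" for A B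
      using * agree[of A B B] F_clopen unfolding subset_iff by blast
  qed (use F_clopen in blast)
  have "G = F" if G: "clopen_filter X T G" "F \<^bold>\<subseteq> G" for G
  proof (rule ext)
    fix A
    have "A \<^bold>\<in> F" if "A \<^bold>\<in> G"
    proof (rule ccontr)
      assume "\<not> A \<^bold>\<in> F"
      have A: "clopen_in X T A" by (rule filter_clopen[OF G(1) that])
      then have "clopen_in X T (sDiff X A)" by (rule clopen_diff[OF top])
      then have "sDiff X A \<^bold>\<in> F"
        using agree[OF A A, of "sDiff X A"] \<open>\<not> A \<^bold>\<in> F\<close> by auto
      then have "sInter A (sDiff X A) \<^bold>\<in> G"
        using filter_inter[OF G(1) that] G(2) unfolding subset_iff by blast
      then show False using filter_nonempty[OF G(1)] by fastforce
    qed
    then show "A \<^bold>\<in> G \<longleftrightarrow> A \<^bold>\<in> F" using G(2) unfolding subset_iff by blast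
  qed
  with filt show "clopen_ultrafilter X T F" unfolding clopen_ultrafilter_def by blast
  show "countable_intersection_property F"
    unfolding countable_intersection_property_def
  proof (intro allI impI, rule ccontr)
    fix H assume H: "H \<^bold>\<subseteq> F \<and> \<not> is_empty H \<and> is_countable H" and free: "\<not> fixed_family H"
    have HF: "A \<^bold>\<in> F" if "A \<^bold>\<in> H" for A using H that unfolding subset_iff by blast
    have "is_countable H" using H by blast
    then obtain g where g: "g \<^bold>\<in> cfuns X T"
      "\<And>x. x \<^bold>\<in> X \<Longrightarrow> \<exists>A. A \<^bold>\<in> H \<and> (\<forall>y. y \<^bold>\<in> X \<longrightarrow> val g y = val g x \<longrightarrow> \<not> y \<^bold>\<in> A)"
      using separating_function[OF top, of H] HF F_clopen free unfolding fixed_family_def by blast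
    obtain x where x: "x \<^bold>\<in> X" "val g x = val p g" using dense[OF g(1) g(1) g(1)] by blast
    obtain A where A: "A \<^bold>\<in> H" "\<And>y. y \<^bold>\<in> X \<Longrightarrow> val g y = val g x \<Longrightarrow> \<not> y \<^bold>\<in> A"
      using g(2)[OF x(1)] by blast
    have "A \<^bold>\<in> F" by (rule HF[OF A(1)])
    then have ind: "indicator X A \<^bold>\<in> cfuns X T" using indicator_cfuns[OF top] F_clopen by blast
    obtain y where y: "y \<^bold>\<in> X" "val g y = val p g" "val (indicator X A) y = val p (indicator X A)"
      using dense[OF g(1) ind ind] by blast
    then have "y \<^bold>\<in> A" using \<open>A \<^bold>\<in> F\<close> F val_indicator_eq_one by metis
    with A(2) y x(2) show False by simp
  qed
qed

text \<open>Evaluation at the points of \<open>X\<close> is a homeomorphism onto a closed subspace of the power with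
  exponent the set of all continuous functions into \<open>\<omega>\<close>.\<close>

lemma fixed_imp_N_compact:
  assumes top: "topological_space X T" and zd: "zero_dimensional X T" and T1: "T1_space X T"
    and fixed: "\<And>F. clopen_ultrafilter X T F \<Longrightarrow> countable_intersection_property F \<Longrightarrow> fixed_family F"
  shows "N_compact X T"
proof -
  define J where "J = cfuns X T"
  define P where "P = funs J omega"
  define E where "E x = eval_map J x" for x
  obtain TP where pow: "is_power_space P TP omega (sPow omega) J"
    using power_space_exists unfolding P_def by blast
  have P: "z \<^bold>\<in> P \<longleftrightarrow> is_function z J omega" for z unfolding P_def by simp
  have topP: "topological_space P TP" by (rule power_space_topology[OF pow])
  have E_P: "E x \<^bold>\<in> P" if "x \<^bold>\<in> X" for x
    unfolding P E_def J_def by (rule eval_map_function[OF that])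
  have E_val: "val (E x) f = val f x" if "f \<^bold>\<in> J" for x f
    unfolding E_def using that by simp
  have ind: "indicator X A \<^bold>\<in> J" if "clopen_in X T A" for A
    unfolding J_def by (rule indicator_cfuns[OF top that])
  have E_term: "definable_term (\<lambda>s. E (s i))" for i
    unfolding E_def by (intro definable_rules)
  define C where "C = repl X E"
  have C: "z \<^bold>\<in> C \<longleftrightarrow> (\<exists>x. x \<^bold>\<in> X \<and> z = E x)" for z
    unfolding C_def by (rule mem_repl[OF E_term])
  define TC where "TC = repl TP (\<lambda>V. sInter V C)"
  have TC: "W \<^bold>\<in> TC \<longleftrightarrow> (\<exists>V. V \<^bold>\<in> TP \<and> W = sInter V C)" for W
    unfolding TC_def by (rule mem_repl) (intro definable_rules)
  have E_inj: "x = y" if xy: "x \<^bold>\<in> X" "y \<^bold>\<in> X" "E x = E y" for x y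
  proof (rule ccontr)
    assume "x \<noteq> y"
    then obtain U where "U \<^bold>\<in> T" "x \<^bold>\<in> U" "\<not> y \<^bold>\<in> U"
      using T1 xy(1,2) unfolding T1_space_def by blast
    then obtain A where A: "clopen_in X T A" "x \<^bold>\<in> A" "\<not> y \<^bold>\<in> A"
      using zero_dimensional_nbhd[OF zd] unfolding subset_iff by blast
    have "val (indicator X A) x = val (indicator X A) y"
      using E_val[OF ind[OF A(1)]] that(3) by metis
    then show False using A(2,3) that(1,2) by (simp add: val_indicator)
  qed
  define e where "e = lam X E"
  define e' where "e' = lam C (\<lambda>z. unique (\<lambda>x. x \<^bold>\<in> X \<and> E x = z))"
  have e'_term: "definable_term (\<lambda>s. unique (\<lambda>x. x \<^bold>\<in> X \<and> E x = s 0))"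
    by (intro definable_rules E_term)
  have inv: "unique (\<lambda>y. y \<^bold>\<in> X \<and> E y = E x) = x" if "x \<^bold>\<in> X" for x
    by (rule unique_eqI) (use that E_inj in auto)
  have e: "is_function e X C"
    unfolding e_def by (rule lam_function[OF E_term]) (auto simp: C)
  have e': "is_function e' C X"
    unfolding e'_def by (rule lam_function[OF e'_term]) (auto simp: C inv)
  have app_e: "app e x z \<longleftrightarrow> x \<^bold>\<in> X \<and> z = E x" for x z
    unfolding e_def by (rule app_lam[OF E_term])
  have app_e': "app e' z x \<longleftrightarrow> app e x z" for x z
    unfolding e'_def app_lam[OF e'_term] app_e by (auto simp: C inv)
  have val_e: "val e x = E x" if "x \<^bold>\<in> X" for x
    unfolding e_def by (rule val_lam[OF E_term that])
  have val_e': "val e' (E x) = x" if "x \<^bold>\<in> X" for x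
    using app_e' app_e that app_function_iff[OF e'] by metis
  have bij: "is_bijection e X C"
    unfolding is_bijection_def app_e using e E_inj by (auto simp: C)
  have e_open: "preimage e X W \<^bold>\<in> T" if "W \<^bold>\<in> TP" for W
  proof -
    \<comment> \<open>The sets with open preimage form a topology, which includes the product topology by
      minimality.\<close>
    define T' where "T' = coll (\<lambda>W. W \<^bold>\<subseteq> P \<and> preimage e X W \<^bold>\<in> T)"
    have T': "W \<^bold>\<in> T' \<longleftrightarrow> W \<^bold>\<subseteq> P \<and> preimage e X W \<^bold>\<in> T" for W
      unfolding T'_def by (rule mem_coll_subset[where A = "sPow P"]) (intro definable_rules, simp)
    have "topological_space P T'"
    proof (rule topological_spaceI)
      have "preimage e X zero = zero" by (rule ext) simp
      then show "zero \<^bold>\<in> T'" using topology_zero[OF top] by (simp add: T' subset_iff)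
      have "preimage e X P = X" by (rule ext) (use val_e E_P in auto)
      then show "P \<^bold>\<in> T'" using topology_whole[OF top] by (simp add: T' subset_iff)
      show "sInter U V \<^bold>\<in> T'" if "U \<^bold>\<in> T'" "V \<^bold>\<in> T'" for U V
      proof -
        have "preimage e X (sInter U V) = sInter (preimage e X U) (preimage e X V)"
          by (rule ext) auto
        then show ?thesis using that topology_inter[OF top] by (simp add: T' subset_iff)
      qed
      show "sUnion S \<^bold>\<in> T'" if "S \<^bold>\<subseteq> T'" for S
      proof -
        have S: "W \<^bold>\<subseteq> P" "preimage e X W \<^bold>\<in> T" if "W \<^bold>\<in> S" for W
          using \<open>S \<^bold>\<subseteq> T'\<close> that unfolding subset_iff[of S] T' by auto
        have "preimage e X (sUnion S) \<^bold>\<in> T"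
        proof (rule topology_local[OF top])
          fix x assume "x \<^bold>\<in> preimage e X (sUnion S)"
          then obtain W where W: "x \<^bold>\<in> X" "W \<^bold>\<in> S" "val e x \<^bold>\<in> W" by auto
          then show "\<exists>V. V \<^bold>\<in> T \<and> x \<^bold>\<in> V \<and> V \<^bold>\<subseteq> preimage e X (sUnion S)"
            using S(2)[OF W(2)] by (intro exI[of _ "preimage e X W"]) (auto simp: subset_iff)
        qed
        then show ?thesis unfolding T' using S(1) by (auto simp: subset_iff)
      qed
    qed (simp add: T')
    then have "TP \<^bold>\<subseteq> T'"
    proof (rule power_space_least[OF pow])
      show "cylinder P f V \<^bold>\<in> T'" if "f \<^bold>\<in> J" for f V
      proof -
        have "preimage e X (cylinder P f V) = preimage f X V"
          by (rule ext) (use that val_e E_P E_val in auto)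
        then show ?thesis
          using cfuns_preimage_open[OF top] that unfolding J_def by (simp add: T' subset_iff)
      qed
    qed
    then show ?thesis using that unfolding subset_iff[of TP] T' by blast
  qed
  have e_cont: "continuous_map e X T C TC"
    unfolding continuous_map_iff
  proof (intro conjI allI impI e)
    fix V assume "V \<^bold>\<in> TC"
    then obtain W where "W \<^bold>\<in> TP" "V = sInter W C" unfolding TC by blast
    moreover from this have "preimage e X V = preimage e X W"
      by (intro ext) (use val_in_codomain[OF e] in auto)
    ultimately show "preimage e X V \<^bold>\<in> T" using e_open by simp
  qed
  have e'_cont: "continuous_map e' C TC X T"
    unfolding continuous_map_iff
  proof (intro conjI allI impI e')
    fix U assume "U \<^bold>\<in> T"
    \<comment> \<open>\<open>U\<close> is a union of clopen sets \<open>A\<close>, and \<open>A\<close> corresponds to the cylinder of points with value 1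
      at the indicator of \<open>A\<close>.\<close>
    define S where "S = coll (\<lambda>W. W \<^bold>\<in> TP \<and> (\<exists>A. clopen_in X T A \<and> A \<^bold>\<subseteq> U \<and> W = cylinder P (indicator X A) (Sing one)))"
    have S: "W \<^bold>\<in> S \<longleftrightarrow> W \<^bold>\<in> TP \<and> (\<exists>A. clopen_in X T A \<and> A \<^bold>\<subseteq> U \<and> W = cylinder P (indicator X A) (Sing one))" for W
      unfolding S_def by (rule mem_sep) (intro definable_rules)
    have cyl: "cylinder P (indicator X A) (Sing one) \<^bold>\<in> TP" if "clopen_in X T A" for A
      by (rule power_space_subbasic[OF pow ind[OF that]]) (simp add: subset_iff)
    have "sUnion S \<^bold>\<in> TP"
      by (rule topology_Union[OF topP]) (simp add: subset_iff[of S] S)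
    moreover have "preimage e' C U = sInter (sUnion S) C"
    proof (rule ext)
      fix z
      have "x \<^bold>\<in> U \<longleftrightarrow> (\<exists>W. W \<^bold>\<in> S \<and> E x \<^bold>\<in> W)" if "x \<^bold>\<in> X" for x
      proof
        assume "x \<^bold>\<in> U"
        then obtain A where "clopen_in X T A" "x \<^bold>\<in> A" "A \<^bold>\<subseteq> U"
          using zero_dimensional_nbhd[OF zd \<open>U \<^bold>\<in> T\<close>] by blast
        then show "\<exists>W. W \<^bold>\<in> S \<and> E x \<^bold>\<in> W"
          using cyl E_P ind that E_val unfolding S
          by (intro exI[of _ "cylinder P (indicator X A) (Sing one)"]) auto
      next
        assume "\<exists>W. W \<^bold>\<in> S \<and> E x \<^bold>\<in> W"
        then obtain A where "clopen_in X T A" "A \<^bold>\<subseteq> U" "val (E x) (indicator X A) = one"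
          unfolding S by auto
        then show "x \<^bold>\<in> U" using that E_val[OF ind] by (auto simp: subset_iff)
      qed
      then show "z \<^bold>\<in> preimage e' C U \<longleftrightarrow> z \<^bold>\<in> sInter (sUnion S) C"
        using val_e' by (auto simp: C)
    qed
    ultimately show "preimage e' C U \<^bold>\<in> TC" unfolding TC by blast
  qed
  \<comment> \<open>A point \<open>p\<close> of the closure gives an ultrafilter. A point \<open>x\<close> fixing it is in the fiber of each
    \<open>f\<close> at \<open>p(f)\<close>, so it is mapped to \<open>p\<close>.\<close>
  have closure: "p \<^bold>\<in> C" if p: "p \<^bold>\<in> P" and meets: "\<And>W. W \<^bold>\<in> TP \<Longrightarrow> p \<^bold>\<in> W \<Longrightarrow> \<exists>z. z \<^bold>\<in> W \<and> z \<^bold>\<in> C" for p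
  proof -
    have dense: "\<exists>x. x \<^bold>\<in> X \<and> val f x = val p f \<and> val g x = val p g \<and> val k x = val p k"
      if "f \<^bold>\<in> J" "g \<^bold>\<in> J" "k \<^bold>\<in> J" for f g k
    proof -
      let ?W = "\<lambda>f. cylinder P f (Sing (val p f))"
      have W: "?W f \<^bold>\<in> TP" if "f \<^bold>\<in> J" for f
      proof (rule power_space_subbasic[OF pow that])
        have "val p f \<^bold>\<in> omega" using val_in_codomain p that unfolding P by blast
        then show "Sing (val p f) \<^bold>\<in> sPow omega" by (simp add: subset_iff)
      qed
      have "sInter (?W f) (sInter (?W g) (?W k)) \<^bold>\<in> TP"
        using that W topology_inter[OF topP] by blast
      then obtain x where "x \<^bold>\<in> X" "E x \<^bold>\<in> sInter (?W f) (sInter (?W g) (?W k))"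
        using meets p C by fastforce
      then show ?thesis using that E_val by auto
    qed
    define F where "F = coll (\<lambda>A. clopen_in X T A \<and> val p (indicator X A) = one)"
    note ultra = closure_point_ultrafilter[OF top dense[unfolded J_def] F_def]
    obtain x where x: "\<And>A. A \<^bold>\<in> F \<Longrightarrow> x \<^bold>\<in> A"
      using fixed ultra(2,3) unfolding fixed_family_def by blast
    have fib: "fiber X (val f) (val p f) \<^bold>\<in> F" if f: "f \<^bold>\<in> J" for f
    proof -
      have clop: "clopen_in X T (fiber X (val f) (val p f))"
        using cfuns_fiber_clopen[OF top] that unfolding J_def by blast
      obtain y where "y \<^bold>\<in> X" "val f y = val p f"
        "val (indicator X (fiber X (val f) (val p f))) y = val p (indicator X (fiber X (val f) (val p f)))"
        using dense[OF f ind[OF clop] ind[OF clop]] by blast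
      then show ?thesis using ultra(1) clop val_indicator_eq_one mem_fiber_val by metis
    qed
    have "x \<^bold>\<in> X" using x[OF fib[OF ind[OF clopen_whole[OF top]]]] by simp
    have "p = E x"
    proof (rule function_eqI)
      show "is_function p J omega" "is_function (E x) J omega"
        using p E_P[OF \<open>x \<^bold>\<in> X\<close>] unfolding P by blast+
      show "val p f = val (E x) f" if "f \<^bold>\<in> J" for f
        using x[OF fib[OF that]] E_val[OF that] by simp
    qed
    then show ?thesis unfolding C using \<open>x \<^bold>\<in> X\<close> by blast
  qed
  have "C \<^bold>\<subseteq> P" using E_P by (auto simp: subset_iff C)
  moreover have "sDiff P C \<^bold>\<in> TP"
  proof (rule topology_local[OF topP])
    fix p assume "p \<^bold>\<in> sDiff P C"
    then obtain W where W: "W \<^bold>\<in> TP" "p \<^bold>\<in> W" "\<And>z. z \<^bold>\<in> W \<Longrightarrow> \<not> z \<^bold>\<in> C"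
      using closure[of p] by auto
    then show "\<exists>V. V \<^bold>\<in> TP \<and> p \<^bold>\<in> V \<and> V \<^bold>\<subseteq> sDiff P C"
      using topology_subset[OF topP W(1)] by (auto simp: subset_iff)
  qed
  ultimately have "closed_in P TP C" by (simp add: closed_in_iff)
  moreover have "is_subspace_topology TC C TP"
    unfolding is_subspace_topology_def is_inter_iff TC by blast
  moreover have "homeomorphic X T C TC"
    unfolding homeomorphic_def using bij app_e' e_cont e'_cont by blast
  moreover have "\<not> is_empty J"
    using ind[OF clopen_whole[OF top]] unfolding is_empty_def by blast
  ultimately show ?thesis
    unfolding N_compact_def is_omega_iff is_Pow_iff using pow by blast
qed

end

theorem theorem5p1:
  fixes mem :: "'v \<Rightarrow> 'v \<Rightarrow> bool" and X T :: 'v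
  assumes "ZF_model mem"
    and "set_structure.topological_space mem X T"
    and "set_structure.zero_dimensional mem X T"
    and "set_structure.T1_space mem X T"
  shows "set_structure.N_compact mem X T \<longleftrightarrow>
    (\<forall>F. set_structure.clopen_ultrafilter mem X T F \<and>
         set_structure.countable_intersection_property mem F \<longrightarrow>
         set_structure.fixed_family mem F)"
proof -
  interpret ZF_model mem by (rule assms(1))
  show ?thesis
    using N_compact_imp_fixed[OF assms(2)] fixed_imp_N_compact[OF assms(2-4)] by blast
qed

end
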